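(* Deciding whether a given graph $G$ is well covered is FPT when parameterized by $\alpha(G)$ and the degeneracy $d$ of $G$; more precisely, it can be solved in $O((d+1)^{\alpha(G)}\cdot(m+n))$ time, where $n$ and $m$ are the numbers of vertices and edges of $G$.
   Context: $\alpha(G)$ is the size of a maximum independent set of $G$. $G$ is well covered if all maximal independent sets of $G$ have the same size. A graph is $d$-degenerate if every induced subgraph has a vertex of degree at most $d$; the degeneracy of $G$ is the smallest $d$ such that $G$ is $d$-degenerate. *)

theory Defs
  imports Main "HOL-Library.Ramsey"
begin

section \<open>Finite simple graphs\<close>

type_synonym 'a graph = "'a set \<times> 'a set set"

abbreviation verts :: "'a graph \<Rightarrow> 'a set" where "verts \<equiv> fst"
abbreviation edges :: "'a graph \<Rightarrow> 'a set set" where "edges \<equiv> snd"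

definition simple_graph :: "'a graph \<Rightarrow> bool" where
  "simple_graph G \<longleftrightarrow> finite (verts G) \<and>
     edges G \<subseteq> {{u, v} | u v. u \<in> verts G \<and> v \<in> verts G \<and> u \<noteq> v}"

definition independent_set :: "'a graph \<Rightarrow> 'a set \<Rightarrow> bool" where
  "independent_set G S \<longleftrightarrow> S \<subseteq> verts G \<and> indep S (edges G)"

definition maximal_independent_set :: "'a graph \<Rightarrow> 'a set \<Rightarrow> bool" where
  "maximal_independent_set G S \<longleftrightarrow>
     independent_set G S \<and> (\<forall>T. independent_set G T \<and> S \<subseteq> T \<longrightarrow> T = S)"

definition alpha :: "'a graph \<Rightarrow> nat" where
  "alpha G = Max {card S | S. independent_set G S}"

definition well_covered :: "'a graph \<Rightarrow> bool" where
  "well_covered G \<longleftrightarrow>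
     (\<forall>S T. maximal_independent_set G S \<and> maximal_independent_set G T \<longrightarrow> card S = card T)"

definition induced_subgraph :: "'a graph \<Rightarrow> 'a set \<Rightarrow> 'a graph" where
  "induced_subgraph G W = (W, {e \<in> edges G. e \<subseteq> W})"

definition degree :: "'a graph \<Rightarrow> 'a \<Rightarrow> nat" where
  "degree G v = card {e \<in> edges G. v \<in> e}"

text \<open>The induced subgraph with no vertices is left out: it has no vertex at all.\<close>

definition degenerate :: "nat \<Rightarrow> 'a graph \<Rightarrow> bool" where
  "degenerate d G \<longleftrightarrow>
     (\<forall>W. W \<subseteq> verts G \<and> W \<noteq> {} \<longrightarrow> (\<exists>v\<in>W. degree (induced_subgraph G W) v \<le> d))"

definition degeneracy :: "'a graph \<Rightarrow> nat" where
  "degeneracy G = (LEAST d. degenerate d G)"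


section \<open>Random access machine\<close>

text \<open>
  A unit-cost random access machine without multiplication, programmed by structured commands.
  A program mentions only finitely many registers; the memory is unbounded and is reached only
  by indirect addressing. Both hold natural numbers, and subtraction is truncated.
\<close>

type_synonym reg = nat
type_synonym state = "(reg \<Rightarrow> nat) \<times> (nat \<Rightarrow> nat)"

datatype test = Less reg reg | Eq reg reg

datatype com =
    Skip
  | Const reg nat
  | Add reg reg reg
  | Sub reg reg reg
  | Load reg reg
  | Store reg reg
  | Seq com com
  | Cond test com com
  | While test com

fun holds :: "test \<Rightarrow> (reg \<Rightarrow> nat) \<Rightarrow> bool" where
  "holds (Less a b) r \<longleftrightarrow> r a < r b"
| "holds (Eq a b) r \<longleftrightarrow> r a = r b"

text \<open>
  \<open>exec c s t s'\<close>: started in \<open>s\<close>, the command \<open>c\<close> halts in \<open>s'\<close> after exactly \<open>t\<close> steps.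
  Every elementary command and every evaluation of a test is one step.
\<close>

inductive exec :: "com \<Rightarrow> state \<Rightarrow> nat \<Rightarrow> state \<Rightarrow> bool" where
  Skip: "exec Skip (r, m) 1 (r, m)"
| Const: "exec (Const x k) (r, m) 1 (r(x := k), m)"
| Add: "exec (Add x a b) (r, m) 1 (r(x := r a + r b), m)"
| Sub: "exec (Sub x a b) (r, m) 1 (r(x := r a - r b), m)"
| Load: "exec (Load x a) (r, m) 1 (r(x := m (r a)), m)"
| Store: "exec (Store a b) (r, m) 1 (r, m(r a := r b))"
| Seq: "exec c1 s1 t1 s2 \<Longrightarrow> exec c2 s2 t2 s3 \<Longrightarrow> exec (Seq c1 c2) s1 (t1 + t2) s3"
| CondTrue: "holds b (fst s) \<Longrightarrow> exec c1 s t s' \<Longrightarrow> exec (Cond b c1 c2) s (1 + t) s'"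
| CondFalse: "\<not> holds b (fst s) \<Longrightarrow> exec c2 s t s' \<Longrightarrow> exec (Cond b c1 c2) s (1 + t) s'"
| WhileFalse: "\<not> holds b (fst s) \<Longrightarrow> exec (While b c) s 1 s"
| WhileTrue: "holds b (fst s1) \<Longrightarrow> exec c s1 t1 s2 \<Longrightarrow> exec (While b c) s2 t2 s3 \<Longrightarrow>
    exec (While b c) s1 (1 + t1 + t2) s3"

inductive_cases exec_SkipE: "exec Skip s t s'"
inductive_cases exec_ConstE: "exec (Const x k) s t s'"
inductive_cases exec_AddE: "exec (Add x a b) s t s'"
inductive_cases exec_SubE: "exec (Sub x a b) s t s'"
inductive_cases exec_LoadE: "exec (Load x a) s t s'"
inductive_cases exec_StoreE: "exec (Store a b) s t s'"
inductive_cases exec_SeqE: "exec (Seq c1 c2) s t s'"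
inductive_cases exec_CondE: "exec (Cond b c1 c2) s t s'"
inductive_cases exec_WhileE: "exec (While b c) s t s'"

lemma exec_deterministic:
  assumes "exec c s t s'" and "exec c s u s''"
  shows "u = t \<and> s'' = s'"
  using assms
proof (induction arbitrary: u s'' rule: exec.induct)
  case (Seq c1 s1 t1 s2 c2 t2 s3)
  from Seq.prems obtain u1 s2' u2
    where *: "exec c1 s1 u1 s2'" "exec c2 s2' u2 s''" "u = u1 + u2"
    by (rule exec_SeqE)
  have 1: "u1 = t1 \<and> s2' = s2" by (rule Seq.IH(1)[OF *(1)])
  have "u2 = t2 \<and> s'' = s3" by (rule Seq.IH(2)) (use 1 *(2) in simp)
  with 1 *(3) show ?case by simp
next
  case (CondTrue b s c1 t s' c2)
  from CondTrue.prems CondTrue.hyps(1) obtain t' where *: "u = 1 + t'" "exec c1 s t' s''"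
    by (auto elim: exec_CondE)
  from CondTrue.IH[OF *(2)] *(1) show ?case by simp
next
  case (CondFalse b s c2 t s' c1)
  from CondFalse.prems CondFalse.hyps(1) obtain t' where *: "u = 1 + t'" "exec c2 s t' s''"
    by (auto elim: exec_CondE)
  from CondFalse.IH[OF *(2)] *(1) show ?case by simp
next
  case (WhileFalse b s c)
  then show ?case by (auto elim: exec_WhileE)
next
  case (WhileTrue b s1 c t1 s2 t2 s3)
  from WhileTrue.prems WhileTrue.hyps(1) obtain u1 s2' u2
    where *: "exec c s1 u1 s2'" "exec (While b c) s2' u2 s''" "u = 1 + u1 + u2"
    by (auto elim: exec_WhileE)
  have 1: "u1 = t1 \<and> s2' = s2" by (rule WhileTrue.IH(1)[OF *(1)])
  have "u2 = t2 \<and> s'' = s3" by (rule WhileTrue.IH(2)) (use 1 *(2) in simp)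
  with 1 *(3) show ?case by simp
qed (auto elim: exec_SkipE exec_ConstE exec_AddE exec_SubE exec_LoadE exec_StoreE)

text \<open>The input word is placed at the beginning of the memory; everything else is zero.\<close>

definition initial_state :: "nat list \<Rightarrow> state" where
  "initial_state w = (\<lambda>_. 0, \<lambda>i. if i < length w then w ! i else 0)"

text \<open>The output is read from register 0.\<close>

definition halts_with :: "com \<Rightarrow> nat list \<Rightarrow> nat \<Rightarrow> nat \<Rightarrow> bool" where
  "halts_with P w y t \<longleftrightarrow> (\<exists>s. exec P (initial_state w) t s \<and> fst s 0 = y)"


section \<open>Fixed-parameter tractability\<close>

definition computable2 :: "(nat \<Rightarrow> nat \<Rightarrow> nat) \<Rightarrow> bool" where
  "computable2 f \<longleftrightarrow> (\<exists>P. \<forall>a b. \<exists>t. halts_with P [a, b] (f a b) t)"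

text \<open>
  The problem \<open>Q\<close> on the instances \<open>I\<close>, parameterized by \<open>p\<close> and \<open>q\<close>; \<open>enc x\<close> is the set of all
  input words that represent the instance \<open>x\<close>. The program is given such a word only, and not
  the values of the parameters.
\<close>

definition fpt2 ::
  "'i set \<Rightarrow> ('i \<Rightarrow> nat list set) \<Rightarrow> ('i \<Rightarrow> bool) \<Rightarrow> ('i \<Rightarrow> nat) \<Rightarrow> ('i \<Rightarrow> nat) \<Rightarrow> bool" where
  "fpt2 I enc Q p q \<longleftrightarrow>
     (\<exists>P f c. computable2 f \<and>
        (\<forall>x\<in>I. \<forall>w\<in>enc x. \<exists>t\<le>f (p x) (q x) * length w ^ c. halts_with P w (of_bool (Q x)) t))"


section \<open>Graphs as inputs\<close>

definition input_graphs :: "nat graph set" where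
  "input_graphs = {G. simple_graph G \<and> verts G = {..<card (verts G)}}"

definition adjacency_lists :: "nat graph \<Rightarrow> nat list list \<Rightarrow> bool" where
  "adjacency_lists G A \<longleftrightarrow> length A = card (verts G) \<and>
     (\<forall>v<length A. distinct (A ! v) \<and> set (A ! v) = {u. {u, v} \<in> edges G})"

text \<open>
  The numbers of vertices and edges, followed by the adjacency lists of the vertices
  \<open>0, 1, \<dots>\<close> in any internal order, each preceded by its length: \<open>2 + n + 2 * m\<close> words in total.
\<close>

definition graph_inputs :: "nat graph \<Rightarrow> nat list set" where
  "graph_inputs G =
     {[card (verts G), card (edges G)] @ concat (map (\<lambda>l. length l # l) A) | A. adjacency_lists G A}"

end

theory Submission
  imports Defs
begin

text \<open>
  Every maximal independent set meets the closed neighbourhood of every vertex \<open>v\<close>. Let \<open>v\<close> have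
  minimum degree in the graph that remains, branch on the at most \<open>d + 1\<close> members \<open>u\<close> of its closed
  neighbourhood, and delete the closed neighbourhood of \<open>u\<close>. The branches of this search tree build
  exactly the maximal independent sets, so the graph is well covered iff all leaves have the same
  depth. The depth is at most \<open>\<alpha>(G)\<close>, and each node costs linear time. If there is an edge, then
  \<open>d + 1 \<ge> 2\<close> and the size of the tree is \<open>O((d + 1)\<^bsup>\<alpha>(G)\<^esup>)\<close>, by a geometric sum.
\<close>

section \<open>Timed total correctness\<close>

text \<open>Neither \<alpha>(G) nor the degeneracy enters the program; they appear only in its
  analysis. A vertex of minimum degree among the remaining vertices has at most
  \<open>degeneracy G\<close> remaining neighbours, and the vertices chosen along a path of the tree
  are independent. Without an adjacency matrix, a closed neighbourhood is deleted by one pass over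
  all adjacency lists, so creating a child costs linear time, just as choosing a pivot does. The
  machine has no call stack, so pending nodes are stored explicitly. Their order does not matter:
  the invariant takes a union over them and the time bound a sum. The tree itself is never
  formalised. Instead, \<open>depths G W k\<close> is defined from the maximal independent sets of
  the remaining graph, and \<open>depths_branch\<close> is the recursion that one visit performs. A
  maximal independent set may be reached along several branches; this is harmless, because only the
  set of leaf depths decides the answer.\<close>

notation Seq (infixr ";;" 60)

definition runs :: "com \<Rightarrow> state \<Rightarrow> nat \<Rightarrow> (state \<Rightarrow> bool) \<Rightarrow> bool" where
  "runs c s T Q \<longleftrightarrow> (\<exists>t s'. exec c s t s' \<and> t \<le> T \<and> Q s')"

lemma runs_Seq:
  assumes "runs c1 s T1 R" and "\<And>s'. R s' \<Longrightarrow> runs c2 s' T2 Q"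
  shows "runs (c1 ;; c2) s (T1 + T2) Q"
  using assms unfolding runs_def by (meson add_mono exec.Seq)

text \<open>Fixes the intermediate state before the final postcondition is chosen. The pivot found
  at run time determines which children are queued and thus the potential in that
  postcondition.\<close>

lemma runs_Seq_obtain:
  assumes "runs c1 s T1 R"
  obtains s' where "R s'" and "\<And>c2 T2 Q. runs c2 s' T2 Q \<Longrightarrow> runs (c1 ;; c2) s (T1 + T2) Q"
  using assms unfolding runs_def by (meson add_mono exec.Seq)

lemma runs_Cond:
  assumes "holds b (fst s) \<Longrightarrow> runs c1 s T Q" and "\<not> holds b (fst s) \<Longrightarrow> runs c2 s T Q"
  shows "runs (Cond b c1 c2) s (1 + T) Q"
  using assms unfolding runs_def by (meson CondFalse CondTrue nat_add_left_cancel_le)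

lemma runs_weaken:
  assumes "runs c s T R" and "T \<le> T'" and "\<And>s'. R s' \<Longrightarrow> Q s'"
  shows "runs c s T' Q"
  using assms unfolding runs_def by (meson order_trans)

text \<open>Each iteration pays for its test and its body out of the potential. Strong induction on
  the potential yields termination and the time bound together; the extra unit is the last, failing
  test.\<close>

lemma runs_While_potential:
  assumes step: "\<And>p s. I p s \<Longrightarrow> holds b (fst s) \<Longrightarrow> \<exists>T q. runs c s T (I q) \<and> Suc T + q \<le> p"
    and "I p s"
  shows "runs (While b c) s (Suc p) (\<lambda>s. (\<exists>p. I p s) \<and> \<not> holds b (fst s))"
  using \<open>I p s\<close>
proof (induction p arbitrary: s rule: less_induct)
  case (less p)
  show ?case
  proof (cases "holds b (fst s)")
    case True
    from step[OF less.prems True] obtain T q where "runs c s T (I q)" and T: "Suc T + q \<le> p"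
      by blast
    then obtain t s1 where 1: "exec c s t s1" "t \<le> T" "I q s1"
      unfolding runs_def by blast
    from T have "q < p" by simp
    from less.IH[OF this 1(3)] obtain u s2 where 2: "exec (While b c) s1 u s2" "u \<le> Suc q"
      "(\<exists>p. I p s2) \<and> \<not> holds b (fst s2)"
      unfolding runs_def by blast
    have "exec (While b c) s (1 + t + u) s2" by (rule WhileTrue[OF True 1(1) 2(1)])
    moreover have "1 + t + u \<le> Suc p" using 1(2) 2(2) T by simp
    ultimately show ?thesis using 2(3) unfolding runs_def by blast
  next
    case False
    have "exec (While b c) s 1 s" by (rule WhileFalse[OF False])
    then show ?thesis using False less.prems unfolding runs_def
      by (intro exI[of _ 1] exI[of _ s]) auto
  qed
qed

lemma runs_While_count:
  assumes init: "I 0 s"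
    and step: "\<And>i s. i < N \<Longrightarrow> I i s \<Longrightarrow> runs c s (T i) (I (Suc i))"
    and test: "\<And>i s. i \<le> N \<Longrightarrow> I i s \<Longrightarrow> holds b (fst s) \<longleftrightarrow> i < N"
  shows "runs (While b c) s (Suc (\<Sum>i<N. Suc (T i))) (I N)"
proof -
  \<comment> \<open>The potential is the time of the iterations still to come.\<close>
  let ?J = "\<lambda>p s. \<exists>i\<le>N. I i s \<and> p = (\<Sum>i=i..<N. Suc (T i))"
  have "runs (While b c) s (Suc (\<Sum>i<N. Suc (T i))) (\<lambda>s. (\<exists>p. ?J p s) \<and> \<not> holds b (fst s))"
  proof (rule runs_While_potential)
    fix p s assume "?J p s" and b: "holds b (fst s)"
    then obtain i where i: "i \<le> N" "I i s" "p = (\<Sum>i=i..<N. Suc (T i))" by blast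
    with test b have "i < N" by blast
    have "runs c s (T i) (?J (\<Sum>i=Suc i..<N. Suc (T i)))"
      by (rule runs_weaken[OF step[OF \<open>i < N\<close> i(2)]]) (use \<open>i < N\<close> in \<open>auto intro!: exI[of _ "Suc i"]\<close>)
    moreover have "Suc (T i) + (\<Sum>i=Suc i..<N. Suc (T i)) \<le> p"
      using \<open>i < N\<close> by (simp add: i(3) sum.atLeast_Suc_lessThan)
    ultimately show "\<exists>T q. runs c s T (?J q) \<and> Suc T + q \<le> p" by blast
  next
    show "?J (\<Sum>i<N. Suc (T i)) s" using init by (auto simp: lessThan_atLeast0)
  qed
  then show ?thesis
    by (rule runs_weaken) (use test in \<open>force+\<close>)
qed

text \<open>Loop-free code is executed symbolically by rewriting with \<open>effect\<close>, so that
  only loops require invariants.\<close>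

fun straight_line :: "com \<Rightarrow> bool" where
  "straight_line (Seq c1 c2) \<longleftrightarrow> straight_line c1 \<and> straight_line c2"
| "straight_line (Cond b c1 c2) \<longleftrightarrow> straight_line c1 \<and> straight_line c2"
| "straight_line (While b c) \<longleftrightarrow> False"
| "straight_line _ \<longleftrightarrow> True"

fun effect :: "com \<Rightarrow> state \<Rightarrow> state" where
  "effect Skip s = s"
| "effect (Const x k) s = ((fst s)(x := k), snd s)"
| "effect (Add x a b) s = ((fst s)(x := fst s a + fst s b), snd s)"
| "effect (Sub x a b) s = ((fst s)(x := fst s a - fst s b), snd s)"
| "effect (Load x a) s = ((fst s)(x := snd s (fst s a)), snd s)"
| "effect (Store a b) s = (fst s, (snd s)(fst s a := fst s b))"
| "effect (Seq c1 c2) s = effect c2 (effect c1 s)"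
| "effect (Cond b c1 c2) s = (if holds b (fst s) then effect c1 s else effect c2 s)"
| "effect (While b c) s = undefined"

fun cost :: "com \<Rightarrow> nat" where
  "cost (Seq c1 c2) = cost c1 + cost c2"
| "cost (Cond b c1 c2) = 1 + max (cost c1) (cost c2)"
| "cost _ = 1"

lemma runs_effect:
  assumes "straight_line c"
  shows "runs c s (cost c) (\<lambda>s'. s' = effect c s)"
  using assms
proof (induction c arbitrary: s)
  case (Seq c1 c2)
  then show ?case by (simp add: runs_Seq[where R = "\<lambda>s'. s' = effect c1 s"])
next
  case (Cond b c1 c2)
  have "runs (Cond b c1 c2) s (1 + max (cost c1) (cost c2)) (\<lambda>s'. s' = effect (Cond b c1 c2) s)"
    by (rule runs_Cond)
      (use Cond in \<open>auto intro: runs_weaken[OF Cond.IH(1)] runs_weaken[OF Cond.IH(2)]\<close>)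
  then show ?case by simp
qed (cases s; force simp: runs_def intro: exec.intros)+

lemma runs_straight_line:
  assumes "straight_line c" and "cost c \<le> T" and "Q (effect c s)"
  shows "runs c s T Q"
  by (rule runs_weaken[OF runs_effect[OF assms(1)] assms(2)]) (simp add: assms(3))

section \<open>Computability of the parameter bound\<close>

definition power_program :: "nat \<Rightarrow> com" where
  "power_program K =
    (Const 1 1 ;; Load 2 9 ;; Load 3 1 ;; Const 0 K) ;;
    While (Less 4 2)
      ((Add 6 0 9 ;; Const 5 0) ;;
       While (Less 5 3) (Add 0 0 6 ;; Add 5 5 1) ;;
       Add 4 4 1)"

text \<open>Multiplication by \<open>b + 1\<close> is done by \<open>b\<close> additions of a saved
  copy, as the machine cannot multiply. Register 9 is never written: its zero serves as the address
  of \<open>a\<close> and as the neutral summand when copying.\<close>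

lemma computable2_power: "computable2 (\<lambda>a b. K * (b + 1) ^ a)"
  unfolding computable2_def
proof (intro exI[of _ "power_program K"] allI)
  fix a b :: nat
  let ?I = "\<lambda>i (r, m :: nat \<Rightarrow> nat).
    r 0 = K * (b + 1) ^ i \<and> r 1 = (1::nat) \<and> r 2 = a \<and> r 3 = b \<and> r 4 = i \<and> r 9 = (0::nat)"
  have inner: "runs ((Add 6 0 9 ;; Const 5 0) ;; While (Less 5 3) (Add 0 0 6 ;; Add 5 5 1) ;; Add 4 4 1)
      s (3 + (Suc (\<Sum>i<b. Suc 2) + 1)) (?I (Suc i))" if s: "?I i s" for i s
  proof (rule runs_Seq)
    let ?J = "\<lambda>j (r, m :: nat \<Rightarrow> nat). r 0 = K * (b + 1) ^ i * (j + 1) \<and> r 1 = (1::nat) \<and> r 2 = a \<and> r 3 = b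
      \<and> r 4 = i \<and> r 9 = (0::nat) \<and> r 6 = K * (b + 1) ^ i \<and> r 5 = j"
    show "runs (Add 6 0 9 ;; Const 5 0) s 3 (?J 0)"
      by (rule runs_straight_line) (use s in \<open>auto split: prod.splits\<close>)
    show "runs (While (Less 5 3) (Add 0 0 6 ;; Add 5 5 1) ;; Add 4 4 1) s
      (Suc (\<Sum>i<b. Suc 2) + 1) (?I (Suc i))" if "?J 0 s" for s
    proof (rule runs_Seq)
      show "runs (While (Less 5 3) (Add 0 0 6 ;; Add 5 5 1)) s (Suc (\<Sum>i<b. Suc 2)) (?J b)"
        by (rule runs_While_count[of ?J, OF that])
          (auto intro!: runs_straight_line simp: algebra_simps)
      show "runs (Add 4 4 1) s 1 (?I (Suc i))" if "?J b s" for s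
        by (rule runs_straight_line) (use that in \<open>auto simp: algebra_simps\<close>)
    qed
  qed
  have "runs (power_program K) (initial_state [a, b])
    (4 + Suc (\<Sum>i<a. Suc (3 + (Suc (\<Sum>i<b. Suc 2) + 1)))) (?I a)"
    unfolding power_program_def
  proof (rule runs_Seq)
    show "runs (Const 1 1 ;; Load 2 9 ;; Load 3 1 ;; Const 0 K) (initial_state [a, b]) 4 (?I 0)"
      by (rule runs_straight_line) (auto simp: initial_state_def)
  qed (erule runs_While_count; use inner in auto)
  then show "\<exists>t. halts_with (power_program K) [a, b] (K * (b + 1) ^ a) t"
    unfolding runs_def halts_with_def by fastforce
qed

section \<open>Branching on a closed neighbourhood\<close>

definition nbrs :: "'a graph \<Rightarrow> 'a \<Rightarrow> 'a set" where
  "nbrs G v = {u. {u, v} \<in> edges G}"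

lemma nbrs_sym: "x \<in> nbrs G y \<longleftrightarrow> y \<in> nbrs G x"
  by (simp add: nbrs_def insert_commute)

text \<open>Maximality is written as domination and is relative to \<open>W\<close>, so that it
  applies to the remaining vertices while the edge set stays that of \<open>G\<close>.\<close>

definition mis_in :: "'a graph \<Rightarrow> 'a set \<Rightarrow> 'a set \<Rightarrow> bool" where
  "mis_in G W S \<longleftrightarrow> S \<subseteq> W \<and> indep S (edges G) \<and> (\<forall>x\<in>W - S. \<exists>y\<in>S. x \<in> nbrs G y)"

lemma maximal_independent_set_iff: "maximal_independent_set G S \<longleftrightarrow> mis_in G (verts G) S"
proof
  assume S: "maximal_independent_set G S"
  then have ind: "S \<subseteq> verts G" "indep S (edges G)"
    by (auto simp: maximal_independent_set_def independent_set_def)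
  have "\<exists>y\<in>S. x \<in> nbrs G y" if "x \<in> verts G - S" for x
  proof (rule ccontr)
    assume "\<not> ?thesis"
    then have "independent_set G (insert x S)"
      using ind that by (auto simp: independent_set_def indep_def nbrs_def insert_commute)
    with S that show False by (auto simp: maximal_independent_set_def)
  qed
  with ind show "mis_in G (verts G) S" by (simp add: mis_in_def)
next
  assume S: "mis_in G (verts G) S"
  show "maximal_independent_set G S"
    unfolding maximal_independent_set_def
  proof (intro conjI allI impI)
    show "independent_set G S" using S by (simp add: mis_in_def independent_set_def)
    fix T assume T: "independent_set G T \<and> S \<subseteq> T"
    have "x \<in> S" if "x \<in> T" for x
    proof (rule ccontr)
      assume "x \<notin> S"
      with S T that obtain y where "y \<in> S" "{x, y} \<in> edges G"
        unfolding mis_in_def nbrs_def independent_set_def by blast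
      with T that \<open>x \<notin> S\<close> show False unfolding independent_set_def indep_def by (metis subsetD)
    qed
    with T show "T = S" by blast
  qed
qed

text \<open>The depths of the leaves below a node at depth \<open>k\<close> with remaining vertices
  \<open>W\<close>, described without reference to the choice of pivots.\<close>

definition depths :: "'a graph \<Rightarrow> 'a set \<Rightarrow> nat \<Rightarrow> nat set" where
  "depths G W k = {k + card S | S. mis_in G W S}"

definition remove_closed_nbrs :: "'a graph \<Rightarrow> 'a set \<Rightarrow> 'a \<Rightarrow> 'a set" where
  "remove_closed_nbrs G W u = W - nbrs G u - {u}"

lemma well_covered_iff_depths:
  "well_covered G \<longleftrightarrow> (\<forall>i\<in>depths G (verts G) k. \<forall>j\<in>depths G (verts G) k. i = j)"
  by (simp add: well_covered_def maximal_independent_set_iff depths_def setcompr_eq_image)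
    blast

lemma depths_empty: "depths G {} k = {k}"
  by (auto simp: depths_def mis_in_def)

text \<open>Removing \<open>u\<close> from a maximal independent set leaves one of the graph without
  the closed neighbourhood of \<open>u\<close>: a surviving vertex is not adjacent to
  \<open>u\<close>, so it is dominated by another member. Conversely, \<open>u\<close> dominates
  exactly the deleted vertices and can be added back.\<close>

lemma depths_branch:
  assumes "finite W" and "v \<in> W" and irrefl: "\<And>x. x \<notin> nbrs G x"
  shows "depths G W k = (\<Union>u\<in>insert v (nbrs G v \<inter> W). depths G (remove_closed_nbrs G W u) (Suc k))"
proof (intro subset_antisym subsetI)
  fix j assume "j \<in> depths G W k"
  then obtain S where S: "mis_in G W S" "j = k + card S" by (auto simp: depths_def)
  \<comment> \<open>Either \<open>v\<close> belongs to \<open>S\<close>, or it is dominated by a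
    member of \<open>S\<close>, which is then a neighbour of \<open>v\<close> in
    \<open>W\<close>.\<close>
  obtain u where u: "u \<in> S" "u \<in> insert v (nbrs G v \<inter> W)"
    using S(1) \<open>v \<in> W\<close> unfolding mis_in_def by (metis DiffI IntI insert_iff nbrs_sym subsetD)
  have "mis_in G (remove_closed_nbrs G W u) (S - {u})"
    unfolding mis_in_def
  proof (intro conjI ballI)
    show "S - {u} \<subseteq> remove_closed_nbrs G W u"
      using S(1) u(1) by (auto simp: mis_in_def indep_def nbrs_def remove_closed_nbrs_def)
    show "indep (S - {u}) (edges G)" using S(1) by (auto simp: mis_in_def indep_def)
    fix x assume x: "x \<in> remove_closed_nbrs G W u - (S - {u})"
    then obtain y where "y \<in> S" "x \<in> nbrs G y"
      using S(1) by (auto simp: mis_in_def remove_closed_nbrs_def)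
    with x show "\<exists>y\<in>S - {u}. x \<in> nbrs G y" by (auto simp: remove_closed_nbrs_def)
  qed
  moreover have "finite S" using S(1) \<open>finite W\<close> finite_subset by (auto simp: mis_in_def)
  then have "j = Suc k + card (S - {u})"
    unfolding S(2) card.remove[OF \<open>finite S\<close> u(1)] by simp
  ultimately show "j \<in> (\<Union>u\<in>insert v (nbrs G v \<inter> W). depths G (remove_closed_nbrs G W u) (Suc k))"
    using u(2) by (fastforce simp: depths_def)
next
  fix j assume "j \<in> (\<Union>u\<in>insert v (nbrs G v \<inter> W). depths G (remove_closed_nbrs G W u) (Suc k))"
  then obtain u S where u: "u \<in> W" and S: "mis_in G (remove_closed_nbrs G W u) S" "j = Suc k + card S"
    using \<open>v \<in> W\<close> by (auto simp: depths_def)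
  have "mis_in G W (insert u S)"
    unfolding mis_in_def
  proof (intro conjI ballI)
    show "insert u S \<subseteq> W" "indep (insert u S) (edges G)"
      using S(1) u by (auto simp: mis_in_def indep_def nbrs_def remove_closed_nbrs_def insert_commute)
    show "\<exists>y\<in>insert u S. x \<in> nbrs G y" if "x \<in> W - insert u S" for x
      using S(1) that by (auto simp: mis_in_def remove_closed_nbrs_def)
  qed
  moreover have "j = k + card (insert u S)"
    using S \<open>finite W\<close> finite_subset[of S W] 
    by (subst card_insert_disjoint) (auto simp: mis_in_def remove_closed_nbrs_def)
  ultimately show "j \<in> depths G W k" by (auto simp: depths_def)
qed

text \<open>Depths are counted from \<open>1\<close>: the program uses \<open>0\<close> for ``no leaf seen yet''.\<close>

definition fits :: "'a graph \<Rightarrow> 'a set \<Rightarrow> nat \<Rightarrow> bool" where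
  "fits G W k \<longleftrightarrow> W \<subseteq> verts G \<and> (\<forall>S\<subseteq>W. indep S (edges G) \<longrightarrow> card S + k \<le> alpha G + 1)"

lemma card_le_alpha:
  assumes "finite (verts G)" and "independent_set G S"
  shows "card S \<le> alpha G"
  unfolding alpha_def
proof (rule Max_ge)
  have "{card S | S. independent_set G S} \<subseteq> card ` Pow (verts G)"
    by (auto simp: independent_set_def)
  then show "finite {card S | S. independent_set G S}"
    using assms(1) finite_subset by blast
qed (use assms in blast)

lemma fits_verts: "finite (verts G) \<Longrightarrow> fits G (verts G) 1"
  by (auto simp: fits_def card_le_alpha independent_set_def)

text \<open>A single vertex is independent, so a node that still has vertices leaves room for at
  least one more level.\<close>

lemma fits_nonempty: "fits G W k \<Longrightarrow> v \<in> W \<Longrightarrow> k \<le> alpha G"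
proof -
  assume "fits G W k" "v \<in> W"
  moreover have "indep {v} (edges G)" by (simp add: indep_def)
  ultimately have "card {v} + k \<le> alpha G + 1" unfolding fits_def by blast
  then show "k \<le> alpha G" by simp
qed

text \<open>Adding \<open>u\<close> turns an independent set of the child into a larger one of the
  parent, which pays for the increased depth.\<close>

lemma fits_child:
  assumes "finite (verts G)" and "fits G W k" and "u \<in> W"
  shows "fits G (remove_closed_nbrs G W u) (Suc k)"
  unfolding fits_def
proof (intro conjI allI impI)
  show "remove_closed_nbrs G W u \<subseteq> verts G"
    using assms by (auto simp: fits_def remove_closed_nbrs_def)
  fix S assume S: "S \<subseteq> remove_closed_nbrs G W u" "indep S (edges G)"
  have "finite S" using S(1) assms finite_subset[of S "verts G"]
    by (auto simp: fits_def remove_closed_nbrs_def)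
  moreover have "insert u S \<subseteq> W" "indep (insert u S) (edges G)"
    using S \<open>u \<in> W\<close> by (auto simp: indep_def nbrs_def remove_closed_nbrs_def insert_commute)
  then have "card (insert u S) + k \<le> alpha G + 1" using assms(2) by (auto simp: fits_def)
  moreover have "u \<notin> S" using S(1) by (auto simp: remove_closed_nbrs_def)
  ultimately show "card S + Suc k \<le> alpha G + 1" by simp
qed

section \<open>Degrees, degeneracy and edge counts\<close>

lemma simple_graph_finite_edges: "simple_graph G \<Longrightarrow> finite (edges G)"
proof -
  assume G: "simple_graph G"
  then have "edges G \<subseteq> Pow (verts G)" unfolding simple_graph_def by blast
  with G show ?thesis by (simp add: simple_graph_def finite_subset)
qed

lemma edgeD:
  assumes "simple_graph G" and "{x, y} \<in> edges G"
  shows "x \<in> verts G" and "y \<in> verts G" and "x \<noteq> y"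
proof -
  obtain u v where "{x, y} = {u, v}" "u \<in> verts G" "v \<in> verts G" "u \<noteq> v"
    using assms unfolding simple_graph_def by blast
  then show "x \<in> verts G" "y \<in> verts G" "x \<noteq> y" by (auto simp: doubleton_eq_iff)
qed

lemma nbrs_irrefl: "simple_graph G \<Longrightarrow> x \<notin> nbrs G x"
  using edgeD(3)[of G x x] by (auto simp: nbrs_def)

lemma nbrs_verts: "simple_graph G \<Longrightarrow> nbrs G x \<subseteq> verts G"
  using edgeD(1)[of G _ x] by (auto simp: nbrs_def)

lemma degree_induced_subgraph:
  assumes "simple_graph G" and "v \<in> W"
  shows "degree (induced_subgraph G W) v = card (nbrs G v \<inter> W)"
proof -
  have "{e \<in> edges (induced_subgraph G W). v \<in> e} = (\<lambda>u. {u, v}) ` (nbrs G v \<inter> W)"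
  proof (intro subset_antisym subsetI)
    fix e assume e: "e \<in> {e \<in> edges (induced_subgraph G W). v \<in> e}"
    then have "e \<in> edges G" by (simp add: induced_subgraph_def)
    then obtain x y where "e = {x, y}" using assms(1) unfolding simple_graph_def by blast
    with e show "e \<in> (\<lambda>u. {u, v}) ` (nbrs G v \<inter> W)"
      by (auto simp: induced_subgraph_def nbrs_def insert_commute)
  qed (use assms in \<open>auto simp: induced_subgraph_def nbrs_def\<close>)
  moreover have "inj_on (\<lambda>u. {u, v}) (nbrs G v \<inter> W)"
    by (auto simp: inj_on_def doubleton_eq_iff)
  ultimately show ?thesis by (simp add: degree_def card_image)
qed

text \<open>The number of edges witnesses that the minimum defining the degeneracy is taken over a
  nonempty set.\<close>

lemma degenerate_degeneracy:
  assumes "simple_graph G"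
  shows "degenerate (degeneracy G) G"
proof -
  have "degree (induced_subgraph G W) v \<le> card (edges G)" for W v
    unfolding degree_def induced_subgraph_def
    by (rule card_mono) (auto simp: simple_graph_finite_edges[OF assms])
  then have "degenerate (card (edges G)) G" by (auto simp: degenerate_def)
  then show ?thesis unfolding degeneracy_def by (rule LeastI)
qed

text \<open>Degeneracy provides some vertex of small degree in the subgraph induced by
  \<open>W\<close>; a vertex of minimum degree does at least as well and can be found without
  knowing the degeneracy.\<close>

lemma min_degree_le_degeneracy:
  assumes "simple_graph G" and "W \<subseteq> verts G" and "v \<in> W"
    and "\<And>x. x \<in> W \<Longrightarrow> card (nbrs G v \<inter> W) \<le> card (nbrs G x \<inter> W)"
  shows "card (nbrs G v \<inter> W) \<le> degeneracy G"
proof -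
  obtain x where "x \<in> W" "degree (induced_subgraph G W) x \<le> degeneracy G"
    using degenerate_degeneracy[OF assms(1)] assms(2,3) unfolding degenerate_def by blast
  with assms show ?thesis by (metis degree_induced_subgraph order_trans)
qed

text \<open>In the subgraph induced by the two ends of an edge, both vertices have positive
  degree.\<close>

lemma degeneracy_pos:
  assumes "simple_graph G" and "edges G \<noteq> {}"
  shows "degeneracy G \<ge> 1"
proof -
  obtain u v where uv: "{u, v} \<in> edges G" "u \<in> verts G" "v \<in> verts G"
    using assms unfolding simple_graph_def by blast
  then obtain x where x: "x \<in> {u, v}" "degree (induced_subgraph G {u, v}) x \<le> degeneracy G"
    using degenerate_degeneracy[OF assms(1)] unfolding degenerate_def by (metis empty_subsetI insert_not_empty insert_subset)
  have "nbrs G x \<inter> {u, v} \<noteq> {}" using x(1) uv(1) by (auto simp: nbrs_def insert_commute)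
  then have "card (nbrs G x \<inter> {u, v}) > 0" by (simp add: card_gt_0_iff)
  with x degree_induced_subgraph[OF assms(1) x(1)] show ?thesis by simp
qed

text \<open>Double counting of ordered adjacent pairs: each edge carries at most two of
  them.\<close>

lemma sum_card_nbrs_le:
  assumes "simple_graph G"
  shows "(\<Sum>v\<in>verts G. card (nbrs G v)) \<le> 2 * card (edges G)"
proof -
  have fin: "finite (verts G)" "finite (edges G)" "\<And>v. finite (nbrs G v)"
    using assms simple_graph_finite_edges[OF assms] nbrs_verts[OF assms]
    by (auto simp: simple_graph_def intro: finite_subset)
  have "(\<Sum>v\<in>verts G. card (nbrs G v)) = card (SIGMA v:verts G. nbrs G v)"
    using fin by simp
  also have "\<dots> \<le> card (\<Union>e\<in>edges G. {(v, u). {v, u} = e})"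
  proof (rule card_mono)
    have "{(v, u). {v, u} = e} \<subseteq> verts G \<times> verts G" if "e \<in> edges G" for e
      using that edgeD(1,2)[OF assms] by blast
    then show "finite (\<Union>e\<in>edges G. {(v, u). {v, u} = e})"
      using fin by (meson finite_SigmaI finite_UN_I finite_subset)
  qed (auto simp: nbrs_def insert_commute)
  also have "\<dots> \<le> (\<Sum>e\<in>edges G. card {(v, u). {v, u} = e})"
    by (rule card_UN_le[OF fin(2)])
  also have "\<dots> \<le> (\<Sum>e\<in>edges G. 2)"
  proof (rule sum_mono)
    fix e assume "e \<in> edges G"
    then obtain x y where "e = {x, y}" using assms unfolding simple_graph_def by blast
    then have e: "{(v, u). {v, u} = e} = {(x, y), (y, x)}"
      by (simp only: doubleton_eq_iff) blast
    have "card {(x, y), (y, x)} \<le> 2" by (cases "x = y") simp_all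
    then show "card {(v, u). {v, u} = e} \<le> 2" by (simp only: e)
  qed
  finally show ?thesis by simp
qed

text \<open>The creation of a child is charged to its parent, hence the summand \<open>b\<close>.\<close>

fun tree_time :: "nat \<Rightarrow> nat \<Rightarrow> nat" where
  "tree_time b 0 = 1"
| "tree_time b (Suc a) = 1 + b + b * tree_time b a"

lemma tree_time_le:
  assumes "b \<ge> 2"
  shows "tree_time b a \<le> 4 * b ^ a"
proof -
  \<comment> \<open>The summand 3 makes the induction close: the step requires
    \<open>b + 4 \<le> 3 * b\<close>, which is \<open>b \<ge> 2\<close>, and the base case is
    \<open>1 + 3 = 4\<close>.\<close>
  have "tree_time b a + 3 \<le> 4 * b ^ a"
  proof (induction a)
    case (Suc a)
    have "b * (tree_time b a + 3) \<le> b * (4 * b ^ a)" by (rule mult_le_mono2[OF Suc.IH])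
    with assms show ?case by (simp add: algebra_simps)
  qed simp
  then show ?thesis by simp
qed

section \<open>The program\<close>

text \<open>
  After the input, the memory holds a queue of blocks of \<open>n + 1\<close> words, one for each node of the
  search tree: its depth, followed by the characteristic vector of its remaining vertices.
  \<open>rH\<close> and \<open>rT\<close> point to the head and to the end of the queue, \<open>rF\<close> to the vector of the head; \<open>rP\<close>
  scans the adjacency lists, and \<open>rQ\<close>, \<open>rQE\<close> delimit the list of the pivot \<open>rPiv\<close>. \<open>rFound\<close> is the
  depth of the first leaf. \<open>rZ\<close> is never written and stays zero.
\<close>

abbreviation (input) rRes :: reg where "rRes \<equiv> 0"
abbreviation (input) rN :: reg where "rN \<equiv> 2"
abbreviation (input) rN1 :: reg where "rN1 \<equiv> 3"
abbreviation (input) rH :: reg where "rH \<equiv> 4"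
abbreviation (input) rF :: reg where "rF \<equiv> 5"
abbreviation (input) rT :: reg where "rT \<equiv> 6"
abbreviation (input) rFound :: reg where "rFound \<equiv> 7"
abbreviation (input) rK :: reg where "rK \<equiv> 8"
abbreviation (input) rP :: reg where "rP \<equiv> 9"
abbreviation (input) rV :: reg where "rV \<equiv> 10"
abbreviation (input) rE :: reg where "rE \<equiv> 11"
abbreviation (input) rC :: reg where "rC \<equiv> 12"
abbreviation (input) rX :: reg where "rX \<equiv> 13"
abbreviation (input) rA :: reg where "rA \<equiv> 14"
abbreviation (input) rBest :: reg where "rBest \<equiv> 15"
abbreviation (input) rPiv :: reg where "rPiv \<equiv> 16"
abbreviation (input) rS :: reg where "rS \<equiv> 17"
abbreviation (input) rQ :: reg where "rQ \<equiv> 18"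
abbreviation (input) rQE :: reg where "rQE \<equiv> 19"
abbreviation (input) rU :: reg where "rU \<equiv> 20"
abbreviation (input) rZ :: reg where "rZ \<equiv> 21"
abbreviation (input) rOne :: reg where "rOne \<equiv> 22"

text \<open>Flags are 0 or 1, so adding up the flags of the listed neighbours counts those that
  remain.\<close>

definition degree_loop :: com where
  "degree_loop = While (Less rP rE)
     (Load rX rP ;; Add rA rF rX ;; Load rX rA ;; Add rC rC rX ;; Add rP rP rOne)"

definition pivot_body :: com where
  "pivot_body =
     (Load rX rP ;; Add rP rP rOne ;; Add rE rP rX ;; Add rS rP rZ ;; Const rC 0) ;;
     degree_loop ;;
     (Add rA rF rV ;; Load rX rA ;;
      Cond (Eq rX rOne)
        (Cond (Less rC rBest)
          (Add rBest rC rZ ;; Add rPiv rV rZ ;; Add rQ rS rZ ;; Add rQE rE rZ) Skip) Skip ;;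
      Add rV rV rOne)"

text \<open>\<open>rBest\<close> starts at \<open>n + 1\<close>, more than any degree; it keeps this
  value exactly when no vertex remains, and \<open>visit_node\<close> recognises leaves by
  it.\<close>

definition find_pivot :: com where
  "find_pivot = (Const rP 2 ;; Const rV 0 ;; Add rBest rN1 rZ) ;; While (Less rV rN) pivot_body"

definition adjacency_loop :: com where
  "adjacency_loop = While (Less rP rE)
     (Load rX rP ;; Cond (Eq rX rU) (Const rC 0) Skip ;; Add rP rP rOne)"

text \<open>By symmetry of adjacency, \<open>v\<close> is deleted with \<open>u\<close> if
  \<open>u\<close> occurs in the list of \<open>v\<close>; hence the lists can be read in the order
  of the input.\<close>

definition child_body :: com where
  "child_body =
     (Load rX rP ;; Add rP rP rOne ;; Add rE rP rX ;; Add rA rF rV ;; Load rC rA ;;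
      Cond (Eq rV rU) (Const rC 0) Skip) ;;
     adjacency_loop ;;
     (Add rA rT rOne ;; Add rA rA rV ;; Store rA rC ;; Add rV rV rOne)"

definition push_child :: com where
  "push_child =
     (Store rT rK ;; Const rP 2 ;; Const rV 0) ;; While (Less rV rN) child_body ;; Add rT rT rN1"

definition push_children :: com where
  "push_children =
     (Load rK rH ;; Add rK rK rOne ;; Add rU rPiv rZ) ;;
     push_child ;;
     While (Less rQ rQE)
       ((Load rU rQ ;; Add rA rF rU ;; Load rX rA) ;;
        Cond (Eq rX rOne) push_child Skip ;;
        Add rQ rQ rOne)"

definition visit_leaf :: com where
  "visit_leaf = Load rX rH ;;
     Cond (Eq rFound rZ) (Add rFound rX rZ) (Cond (Eq rFound rX) Skip (Const rRes 0))"

definition visit_node :: com where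
  "visit_node =
     Add rF rH rOne ;; find_pivot ;;
     Cond (Less rBest rN1) push_children visit_leaf ;;
     Add rH rH rN1"

text \<open>The queue starts at address \<open>2 * m + n + 2\<close>, computed from the two header
  words, which lies beyond the input word.\<close>

definition push_root :: com where
  "push_root =
     (Add rH rX rX ;; Add rH rH rN1 ;; Add rH rH rOne ;; Store rH rOne ;; Add rT rH rOne) ;;
     While (Less rV rN) (Store rT rOne ;; Add rT rT rOne ;; Add rV rV rOne)"

text \<open>Edgeless graphs are treated separately: their search tree is a path of length \<open>n\<close>, on which
  linear time per node would exceed the bound \<open>O((0 + 1)\<^bsup>n\<^esup> * n)\<close>.\<close>

definition well_covered_program :: com where
  "well_covered_program =
     (Const rOne 1 ;; Load rX rOne ;; Load rN rZ ;; Add rN1 rN rOne ;; Const rRes 1) ;;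
     Cond (Eq rX rZ) Skip (push_root ;; While (Less rH rT) visit_node)"

section \<open>Layout of the input word\<close>

locale graph_word =
  fixes G :: "nat graph" and A :: "nat list list"
  assumes input: "G \<in> input_graphs" and adj: "adjacency_lists G A"
begin

definition n :: nat where "n = card (verts G)"

definition word :: "nat list" where
  "word = [card (verts G), card (edges G)] @ concat (map (\<lambda>l. length l # l) A)"

text \<open>The address of the length entry of the list of \<open>v\<close>; \<open>offset n\<close>
  is the length of the whole word.\<close>

definition offset :: "nat \<Rightarrow> nat" where
  "offset v = 2 + (\<Sum>i<v. Suc (length (A ! i)))"

definition has_input :: "(nat \<Rightarrow> nat) \<Rightarrow> bool" where
  "has_input m \<longleftrightarrow> (\<forall>i<length word. m i = word ! i)"

lemma simple: "simple_graph G" and verts: "verts G = {..<n}" and length_A: "length A = n"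
  using input adj by (auto simp: input_graphs_def adjacency_lists_def n_def)

lemma distinct_A: "v < n \<Longrightarrow> distinct (A ! v)"
  and set_A: "v < n \<Longrightarrow> set (A ! v) = nbrs G v"
  using adj length_A by (auto simp: adjacency_lists_def nbrs_def)

lemma nth_A: "v < n \<Longrightarrow> j < length (A ! v) \<Longrightarrow> A ! v ! j \<in> nbrs G v \<and> A ! v ! j < n"
  using set_A[of v] nth_mem[of j "A ! v"] nbrs_verts[OF simple, of v] verts by auto

text \<open>Adjacency lists have no repetitions, so counting entries counts neighbours.\<close>

lemma length_filter_A:
  assumes "v < n"
  shows "length (filter (\<lambda>u. u \<in> W) (A ! v)) = card (nbrs G v \<inter> W)"
  using distinct_card[of "filter (\<lambda>u. u \<in> W) (A ! v)"] distinct_A[OF assms] set_A[OF assms]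
  by (simp add: Int_def conj_commute)

lemma offset_0: "offset 0 = 2"
  and offset_Suc: "offset (Suc v) = offset v + Suc (length (A ! v))"
  by (simp_all add: offset_def)

lemma length_concat_take:
  "v \<le> n \<Longrightarrow> length (concat (map (\<lambda>l. length l # l) (take v A))) + 2 = offset v"
  by (induction v) (simp_all add: offset_0 offset_Suc take_Suc_conv_app_nth length_A)

lemma length_word: "length word = offset n"
  using length_concat_take[of n] by (simp add: word_def length_A)

lemma sum_length_A: "(\<Sum>v<n. length (A ! v)) \<le> 2 * card (edges G)"
proof -
  have "(\<Sum>v<n. length (A ! v)) = (\<Sum>v\<in>verts G. card (nbrs G v))"
    using distinct_A set_A distinct_card by (intro sum.cong) (fastforce simp: verts)+
  with sum_card_nbrs_le[OF simple] show ?thesis by simp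
qed

lemma offset_eq: "offset n = 2 + n + (\<Sum>v<n. length (A ! v))"
  by (simp add: offset_def sum_Suc)

lemma length_word_le: "length word \<le> 2 + n + 2 * card (edges G)"
  using sum_length_A by (simp add: length_word offset_eq)

lemma nth_word:
  assumes "v < n" and "j \<le> length (A ! v)"
  shows "word ! (offset v + j) = (length (A ! v) # A ! v) ! j" and "offset v + j < length word"
proof -
  let ?f = "\<lambda>l. length l # l"
  have "A = take v A @ A ! v # drop (Suc v) A"
    using assms by (simp add: length_A id_take_nth_drop)
  then have c: "concat (map ?f A) = concat (map ?f (take v A @ A ! v # drop (Suc v) A))"
    by (rule arg_cong)
  have w: "word = ([card (verts G), card (edges G)] @ concat (map ?f (take v A))) @
      ?f (A ! v) @ concat (map ?f (drop (Suc v) A))" (is "_ = ?p @ _ @ ?q")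
    unfolding word_def c by simp
  have p: "length ?p = offset v" using length_concat_take[of v] assms by simp
  have "word ! (length ?p + j) = (?f (A ! v) @ ?q) ! j"
    unfolding w by (rule nth_append_length_plus)
  also have "\<dots> = ?f (A ! v) ! j" using assms(2) by (subst nth_append) simp
  finally show "word ! (offset v + j) = (length (A ! v) # A ! v) ! j" unfolding p .
  have "length word = length ?p + (Suc (length (A ! v)) + length ?q)"
    unfolding w by simp
  with assms(2) show "offset v + j < length word" unfolding p by simp
qed

lemma has_inputD:
  assumes "has_input m" and "v < n"
  shows "m (offset v) = length (A ! v)"
    and "j < length (A ! v) \<Longrightarrow> m (Suc (offset v + j)) = A ! v ! j"
  using assms nth_word[OF assms(2), of 0] nth_word[OF assms(2), of "Suc j"]
  by (auto simp: has_input_def)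

lemma has_input_cong: "has_input m \<Longrightarrow> (\<And>i. i < length word \<Longrightarrow> m' i = m i) \<Longrightarrow> has_input m'"
  by (simp add: has_input_def)

section \<open>Search for a vertex of minimum remaining degree\<close>

definition flags :: "(nat \<Rightarrow> nat) \<Rightarrow> nat \<Rightarrow> nat set \<Rightarrow> bool" where
  "flags m a W \<longleftrightarrow> (\<forall>x<n. m (a + x) = of_bool (x \<in> W))"

lemma degree_loop:
  assumes m: "has_input m" "flags m (r rF) W" and v: "v < n"
    and r: "r rP = Suc (offset v)" "r rE = offset (Suc v)" "r rC = 0" "r rOne = 1"
  shows "runs degree_loop (r, m) (1 + 6 * length (A ! v)) (\<lambda>(r', m'). m' = m \<and>
    r' rC = card (nbrs G v \<inter> W) \<and> r' rP = offset (Suc v) \<and>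
    (\<forall>i. i \<notin> {rP, rC, rX, rA} \<longrightarrow> r' i = r i))"
proof -
  define I where "I = (\<lambda>j (r', m'). m' = m \<and> r' rP = Suc (offset v + j) \<and>
    r' rC = length (filter (\<lambda>x. x \<in> W) (take j (A ! v))) \<and>
    (\<forall>i. i \<notin> {rP, rC, rX, rA} \<longrightarrow> r' i = r i))"
  have "runs degree_loop (r, m) (Suc (\<Sum>j<length (A ! v). Suc 5)) (I (length (A ! v)))"
    unfolding degree_loop_def
  proof (rule runs_While_count)
    show "I 0 (r, m)" using r by (simp add: I_def)
    fix j s assume j: "j < length (A ! v)" and s: "I j s"
    obtain r' m' where [simp]: "s = (r', m')" by fastforce
    show "runs (Load rX rP ;; Add rA rF rX ;; Load rX rA ;; Add rC rC rX ;; Add rP rP rOne) s 5 (I (Suc j))"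
      by (rule runs_straight_line)
        (use s j m v r nth_A[OF v j] in
          \<open>auto simp: I_def has_inputD flags_def take_Suc_conv_app_nth\<close>)
  next
    fix j s assume "j \<le> length (A ! v)" "I j s"
    then show "holds (Less rP rE) (fst s) \<longleftrightarrow> j < length (A ! v)"
      by (cases s) (auto simp: I_def r offset_Suc)
  qed
  then show ?thesis
    by (rule runs_weaken) (auto simp: I_def offset_Suc length_filter_A[OF v])
qed

lemma card_nbrs_le: "card (nbrs G v \<inter> W) \<le> n"
  using card_mono[of "{..<n}" "nbrs G v \<inter> W"] nbrs_verts[OF simple, of v] verts by auto

text \<open>The invariant after scanning the vertices below \<open>v\<close>. The sentinel
  \<open>Suc n\<close> cannot be a degree, so it separates the two cases; \<open>q\<close> and
  \<open>e\<close> delimit the list of the pivot for the later branching.\<close>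

definition pivot_found :: "nat set \<Rightarrow> nat \<Rightarrow> nat \<Rightarrow> nat \<Rightarrow> nat \<Rightarrow> nat \<Rightarrow> bool" where
  "pivot_found W v best piv q e \<longleftrightarrow>
     (if \<exists>x<v. x \<in> W
      then piv < n \<and> piv \<in> W \<and> best = card (nbrs G piv \<inter> W) \<and> best \<le> n \<and>
        (\<forall>x<v. x \<in> W \<longrightarrow> best \<le> card (nbrs G x \<inter> W)) \<and>
        q = Suc (offset piv) \<and> e = offset (Suc piv)
      else best = Suc n)"

lemma pivot_found_update:
  assumes "pivot_found W v best piv q e" and "v < n" and "v \<in> W" and "card (nbrs G v \<inter> W) < best"
  shows "pivot_found W (Suc v) (card (nbrs G v \<inter> W)) v (Suc (offset v)) (offset (Suc v))"
proof -
  have "card (nbrs G v \<inter> W) \<le> card (nbrs G x \<inter> W)" if "x < Suc v" "x \<in> W" for x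
  proof (cases "x = v")
    case False
    with that have "x < v" by simp
    with that have "best \<le> card (nbrs G x \<inter> W)"
      using assms(1) unfolding pivot_found_def by (metis (no_types))
    with assms(4) show ?thesis by simp
  qed simp
  with assms(2,3) card_nbrs_le[of v W] show ?thesis by (auto simp: pivot_found_def)
qed

lemma pivot_found_keep:
  assumes "pivot_found W v best piv q e" and "v \<in> W \<Longrightarrow> \<not> card (nbrs G v \<inter> W) < best"
  shows "pivot_found W (Suc v) best piv q e"
proof (cases "\<exists>x<v. x \<in> W")
  case True
  then have "\<exists>x<Suc v. x \<in> W" using less_SucI by blast
  with True assms show ?thesis unfolding pivot_found_def by (simp add: less_Suc_eq) (metis not_less)
next
  case False
  \<comment> \<open>With the sentinel still in place, any vertex of \<open>W\<close> would have
    forced an update.\<close>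
  with assms card_nbrs_le[of v W] have "v \<notin> W" by (auto simp: pivot_found_def)
  with False have "\<not> (\<exists>x<Suc v. x \<in> W)" by (auto simp: less_Suc_eq)
  with False assms show ?thesis by (simp add: pivot_found_def)
qed

lemma pivot_body:
  assumes m: "has_input m" "flags m (r rF) W" and v: "v < n"
    and r: "r rP = offset v" "r rV = v" "r rOne = 1" "r rZ = 0" "pivot_found W v (r rBest) (r rPiv) (r rQ) (r rQE)"
  shows "runs pivot_body (r, m) (15 + 6 * length (A ! v)) (\<lambda>(r', m'). m' = m \<and>
    r' rP = offset (Suc v) \<and> r' rV = Suc v \<and> pivot_found W (Suc v) (r' rBest) (r' rPiv) (r' rQ) (r' rQE) \<and>
    (\<forall>i. i \<notin> {rP, rV, rE, rC, rX, rA, rBest, rPiv, rS, rQ, rQE} \<longrightarrow> r' i = r i))"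
    (is "runs _ _ _ ?Q")
proof -
  define R0 where "R0 = (\<lambda>(r', m'). m' = m \<and> r' rP = Suc (offset v) \<and> r' rE = offset (Suc v) \<and>
    r' rC = 0 \<and> r' rS = Suc (offset v) \<and> (\<forall>i. i \<notin> {rP, rX, rE, rC, rS} \<longrightarrow> r' i = r i))"
  define R1 where "R1 = (\<lambda>(r', m'). m' = m \<and> r' rP = offset (Suc v) \<and> r' rE = offset (Suc v) \<and>
    r' rC = card (nbrs G v \<inter> W) \<and> r' rS = Suc (offset v) \<and>
    (\<forall>i. i \<notin> {rP, rX, rE, rC, rS, rA} \<longrightarrow> r' i = r i))"
  have "runs pivot_body (r, m) (5 + ((1 + 6 * length (A ! v)) + 9)) ?Q"
    unfolding pivot_body_def
  proof (rule runs_Seq[where R = R0], goal_cases)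
    case 1
    show ?case
      by (rule runs_straight_line)
        (use m v r in \<open>auto simp: R0_def has_inputD offset_Suc\<close>)
  next
    case (2 s)
    obtain r' m' where s: "s = (r', m')" by fastforce
    show ?case
    proof (rule runs_Seq[where R = R1], goal_cases)
      case 1
      show ?case unfolding s
        by (rule runs_weaken[OF degree_loop[where v = v and W = W]])
          (use 2 m v r in \<open>auto simp: R0_def R1_def s\<close>)
    next
      case (2 s)
      obtain r' m' where s: "s = (r', m')" by fastforce
      have "m (r rF + v) = of_bool (v \<in> W)" using m(2) v by (simp add: flags_def)
      moreover have r': "m' = m" "r' rP = offset (Suc v)" "r' rE = offset (Suc v)"
        "r' rC = card (nbrs G v \<inter> W)" "r' rS = Suc (offset v)" "r' rF = r rF" "r' rV = v"
        "r' rBest = r rBest" "r' rPiv = r rPiv" "r' rQ = r rQ" "r' rQE = r rQE" "r' rOne = 1" "r' rZ = 0"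
        using 2 r by (auto simp: R1_def s)
      moreover have "\<And>i. i \<notin> {rP, rX, rE, rC, rS, rA} \<Longrightarrow> r' i = r i"
        using 2 by (auto simp: R1_def s)
      ultimately show ?case unfolding s
        by (intro runs_straight_line)
          (use pivot_found_update[OF r(5) v] pivot_found_keep[OF r(5)] in auto)
    qed
  qed
  then show ?thesis by (rule runs_weaken) auto
qed

lemma find_pivot:
  assumes m: "has_input m" "flags m (r rF) W"
    and r: "r rOne = 1" "r rZ = 0" "r rN = n" "r rN1 = Suc n"
  shows "runs find_pivot (r, m) (16 * length word) (\<lambda>(r', m'). m' = m \<and>
    pivot_found W n (r' rBest) (r' rPiv) (r' rQ) (r' rQE) \<and>
    (\<forall>i. i \<notin> {rP, rV, rE, rC, rX, rA, rBest, rPiv, rS, rQ, rQE} \<longrightarrow> r' i = r i))"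
    (is "runs _ _ _ ?Q")
proof -
  define I where "I = (\<lambda>v (r', m'). m' = m \<and> r' rP = offset v \<and> r' rV = v \<and>
    pivot_found W v (r' rBest) (r' rPiv) (r' rQ) (r' rQE) \<and>
    (\<forall>i. i \<notin> {rP, rV, rE, rC, rX, rA, rBest, rPiv, rS, rQ, rQE} \<longrightarrow> r' i = r i))"
  have "runs find_pivot (r, m) (3 + Suc (\<Sum>v<n. Suc (15 + 6 * length (A ! v)))) (I n)"
    unfolding find_pivot_def
  proof (rule runs_Seq[where R = "I 0"], goal_cases)
    case 1
    show ?case
      by (rule runs_straight_line) (auto simp: I_def offset_0 pivot_found_def r)
  next
    case (2 s)
    then show ?case
    proof (rule runs_While_count, goal_cases)
      case (1 v s)
      obtain r' m' where s: "s = (r', m')" by fastforce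
      show ?case unfolding s
        by (rule runs_weaken[OF pivot_body[where W = W and v = v]])
          (use 1 m r in \<open>auto simp: I_def s\<close>)
    next
      case (2 v s)
      then show ?case using r by (cases s) (auto simp: I_def)
    qed
  qed
  moreover have "3 + Suc (\<Sum>v<n. Suc (15 + 6 * length (A ! v))) \<le> 16 * length word"
    by (simp add: length_word offset_eq sum_Suc sum.distrib flip: sum_distrib_left)
  ultimately show ?thesis
    by (rule runs_weaken) (auto simp: I_def)
qed

section \<open>Creation of a child node\<close>

lemma adjacency_loop:
  assumes m: "has_input m" and v: "v < n"
    and r: "r rP = Suc (offset v)" "r rE = offset (Suc v)" "r rOne = 1"
  shows "runs adjacency_loop (r, m) (1 + 5 * length (A ! v)) (\<lambda>(r', m'). m' = m \<and>
    r' rC = (if r rU \<in> nbrs G v then 0 else r rC) \<and> r' rP = offset (Suc v) \<and>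
    (\<forall>i. i \<notin> {rP, rC, rX} \<longrightarrow> r' i = r i))"
proof -
  define I where "I = (\<lambda>j (r', m'). m' = m \<and> r' rP = Suc (offset v + j) \<and>
    r' rC = (if r rU \<in> set (take j (A ! v)) then 0 else r rC) \<and>
    (\<forall>i. i \<notin> {rP, rC, rX} \<longrightarrow> r' i = r i))"
  have "runs adjacency_loop (r, m) (Suc (\<Sum>j<length (A ! v). Suc 4)) (I (length (A ! v)))"
    unfolding adjacency_loop_def
  proof (rule runs_While_count, goal_cases)
    case 1
    show ?case using r by (simp add: I_def)
  next
    case (2 j s)
    obtain r' m' where s: "s = (r', m')" by fastforce
    show ?case
      by (rule runs_straight_line)
        (use 2 m v r in \<open>auto simp: I_def s has_inputD take_Suc_conv_app_nth\<close>)
  next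
    case (3 j s)
    then show ?case by (cases s) (auto simp: I_def r offset_Suc)
  qed
  then show ?thesis
    by (rule runs_weaken) (auto simp: I_def offset_Suc set_A[OF v])
qed

lemma child_body:
  assumes m: "has_input m" "flags m (r rF) W" and v: "v < n"
    and r: "r rP = offset v" "r rV = v" "r rOne = 1"
  shows "runs child_body (r, m) (12 + 5 * length (A ! v)) (\<lambda>(r', m').
    m' = m(r rT + 1 + v := of_bool (v \<in> remove_closed_nbrs G W (r rU))) \<and>
    r' rP = offset (Suc v) \<and> r' rV = Suc v \<and>
    (\<forall>i. i \<notin> {rP, rV, rE, rC, rX, rA} \<longrightarrow> r' i = r i))"
    (is "runs _ _ _ ?Q")
proof -
  define R0 where "R0 = (\<lambda>(r', m'). m' = m \<and> r' rP = Suc (offset v) \<and> r' rE = offset (Suc v) \<and>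
    r' rC = of_bool (v \<in> W - {r rU}) \<and> (\<forall>i. i \<notin> {rP, rX, rE, rC, rA} \<longrightarrow> r' i = r i))"
  define R1 where "R1 = (\<lambda>(r', m'). m' = m \<and> r' rP = offset (Suc v) \<and>
    r' rC = of_bool (v \<in> remove_closed_nbrs G W (r rU)) \<and>
    (\<forall>i. i \<notin> {rP, rX, rE, rC, rA} \<longrightarrow> r' i = r i))"
  have f: "m (r rF + v) = of_bool (v \<in> W)" using m(2) v by (simp add: flags_def)
  have "runs child_body (r, m) (7 + ((1 + 5 * length (A ! v)) + 4)) ?Q"
    unfolding child_body_def
  proof (rule runs_Seq[where R = R0], goal_cases)
    case 1
    show ?case
      by (rule runs_straight_line)
        (use f m v r in \<open>auto simp: R0_def has_inputD offset_Suc\<close>)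
  next
    case (2 s)
    obtain r' m' where s: "s = (r', m')" by fastforce
    show ?case
    proof (rule runs_Seq[where R = R1], goal_cases)
      case 1
      show ?case unfolding s
        by (rule runs_weaken[OF adjacency_loop[where v = v]])
          (use 2 m v r nbrs_sym[of v G "r rU"] in
            \<open>auto simp: R0_def R1_def s remove_closed_nbrs_def\<close>)
    next
      case (2 s)
      obtain r' m' where s: "s = (r', m')" by fastforce
      show ?case unfolding s
        by (rule runs_straight_line) (use 2 r in \<open>auto simp: R1_def s\<close>)
    qed
  qed
  then show ?thesis by (rule runs_weaken) auto
qed

lemma flags_cong: "flags m a W \<Longrightarrow> (\<And>i. a \<le> i \<Longrightarrow> i < a + n \<Longrightarrow> m' i = m i) \<Longrightarrow> flags m' a W"
  by (simp add: flags_def)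

definition block :: "(nat \<Rightarrow> nat) \<Rightarrow> nat \<Rightarrow> nat set \<Rightarrow> nat \<Rightarrow> bool" where
  "block m a W k \<longleftrightarrow> m a = k \<and> flags m (Suc a) W"

lemma block_cong: "block m a W k \<Longrightarrow> (\<And>i. a \<le> i \<Longrightarrow> i < a + Suc n \<Longrightarrow> m' i = m i) \<Longrightarrow> block m' a W k"
  by (auto simp: block_def intro: flags_cong)

text \<open>All writes go to addresses from \<open>r rT\<close> on. The two bounds on
  \<open>r rT\<close> keep the input and the flags of the parent, which are read during the copy,
  out of their reach.\<close>

lemma push_child_block:
  assumes m: "has_input m" "flags m (r rF) W" and le: "length word \<le> r rT" "r rF + n \<le> r rT"
    and r: "r rOne = 1" "r rN = n" "r rN1 = Suc n"
  shows "runs push_child (r, m) (13 * length word) (\<lambda>(r', m').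
    r' rT = r rT + Suc n \<and> (\<forall>a<r rT. m' a = m a) \<and>
    block m' (r rT) (remove_closed_nbrs G W (r rU)) (r rK) \<and>
    (\<forall>i. i \<notin> {rP, rV, rE, rC, rX, rA, rT} \<longrightarrow> r' i = r i))"
    (is "runs _ _ _ ?Q")
proof -
  define I where "I = (\<lambda>v (r', m'). r' rP = offset v \<and> r' rV = v \<and>
    (\<forall>a<r rT. m' a = m a) \<and> m' (r rT) = r rK \<and>
    (\<forall>x<v. m' (Suc (r rT + x)) = of_bool (x \<in> remove_closed_nbrs G W (r rU))) \<and>
    (\<forall>i. i \<notin> {rP, rV, rE, rC, rX, rA} \<longrightarrow> r' i = r i))"
  have "runs push_child (r, m) (3 + (Suc (\<Sum>v<n. Suc (12 + 5 * length (A ! v))) + 1)) ?Q"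
    unfolding push_child_def
  proof (rule runs_Seq[where R = "I 0"], goal_cases)
    case 1
    show ?case by (rule runs_straight_line) (auto simp: I_def offset_0)
  next
    case (2 s)
    show ?case
    proof (rule runs_Seq[where R = "I n"], rule runs_While_count, goal_cases)
      case 1
      show ?case by (rule 2)
    next
      case (2 v s)
      obtain r' m' where s: "s = (r', m')" by fastforce
      have m': "has_input m'" "flags m' (r rF) W"
        using 2(2) le by (auto simp: I_def s intro!: has_input_cong[OF m(1)] flags_cong[OF m(2)])
      show ?case unfolding s
        by (rule runs_weaken[OF child_body[where W = W and v = v]])
          (use 2 m' r in \<open>auto simp: I_def s less_Suc_eq\<close>)
    next
      case (3 v s)
      then show ?case using r by (cases s) (auto simp: I_def)
    next
      case (4 s)
      obtain r' m' where s: "s = (r', m')" by fastforce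
      show ?case unfolding s
        by (rule runs_straight_line) (use 4 r in \<open>auto simp: I_def s block_def flags_def\<close>)
    qed
  qed
  moreover have "3 + (Suc (\<Sum>v<n. Suc (12 + 5 * length (A ! v))) + 1) \<le> 13 * length word"
    by (simp add: length_word offset_eq sum_Suc sum.distrib flip: sum_distrib_left)
  ultimately show ?thesis by (rule runs_weaken) auto
qed

section \<open>The queue of pending nodes\<close>

fun queue :: "(nat \<Rightarrow> nat) \<Rightarrow> nat \<Rightarrow> (nat set \<times> nat) list \<Rightarrow> nat \<Rightarrow> bool" where
  "queue m a [] b \<longleftrightarrow> a = b"
| "queue m a ((W, k) # ws) b \<longleftrightarrow> block m a W k \<and> queue m (a + Suc n) ws b"

lemma queue_length: "queue m a ws b \<Longrightarrow> b = a + length ws * Suc n"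
  by (induction m a ws b rule: queue.induct) auto

lemma queue_cong: "queue m a ws b \<Longrightarrow> (\<And>i. a \<le> i \<Longrightarrow> i < b \<Longrightarrow> m' i = m i) \<Longrightarrow> queue m' a ws b"
proof (induction m a ws b rule: queue.induct)
  case (2 m a W k ws b)
  from 2(2) queue_length have "b = a + Suc n + length ws * Suc n" by fastforce
  with 2 show ?case by (auto intro: block_cong)
qed simp

lemma queue_snoc: "queue m a ws b \<Longrightarrow> block m b W k \<Longrightarrow> queue m a (ws @ [(W, k)]) (b + Suc n)"
  by (induction m a ws b rule: queue.induct) auto

text \<open>The bound \<open>length word \<le> r rH\<close> protects the input, since the queue only
  grows at its end and is never moved back.\<close>

definition store :: "(nat set \<times> nat) list \<Rightarrow> state \<Rightarrow> bool" where
  "store ws = (\<lambda>(r, m). has_input m \<and> queue m (r rH) ws (r rT) \<and> length word \<le> r rH \<and>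
     r rOne = 1 \<and> r rZ = 0 \<and> r rN = n \<and> r rN1 = Suc n)"

lemma push_child:
  assumes st: "store ws (r, m)" and ws: "ws = (W, k) # ws'" and r: "r rF = Suc (r rH)" "r rK = Suc k"
  shows "runs push_child (r, m) (13 * length word) (\<lambda>(r', m').
    store (ws @ [(remove_closed_nbrs G W (r rU), Suc k)]) (r', m') \<and>
    (\<forall>i. i \<notin> {rP, rV, rE, rC, rX, rA, rT} \<longrightarrow> r' i = r i))"
proof -
  have q: "has_input m" "queue m (r rH) ws (r rT)" "length word \<le> r rH"
    "r rOne = 1" "r rZ = 0" "r rN = n" "r rN1 = Suc n"
    using st by (auto simp: store_def)
  have f: "flags m (r rF) W" using q(2) r by (simp add: ws block_def)
  have le: "r rF + n \<le> r rT" using queue_length[OF q(2)] r by (simp add: ws)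
  have le': "length word \<le> r rT" using le q(3) r by simp
  show ?thesis
  proof (rule runs_weaken[OF push_child_block[OF q(1) f le' le q(4,6,7)] order_refl], goal_cases)
    case (1 s)
    obtain r' m' where s: "s = (r', m')" by fastforce
    have r': "r' rT = r rT + Suc n" "\<And>a. a < r rT \<Longrightarrow> m' a = m a"
      "block m' (r rT) (remove_closed_nbrs G W (r rU)) (Suc k)"
      "\<And>i. i \<notin> {rP, rV, rE, rC, rX, rA, rT} \<Longrightarrow> r' i = r i"
      using 1 r(2) by (auto simp: s)
    have "has_input m'" by (rule has_input_cong[OF q(1)]) (use r'(2) le' in simp)
    moreover have "queue m' (r rH) ws (r rT)" by (rule queue_cong[OF q(2)]) (use r'(2) in simp)
    ultimately show ?case
      using r' q by (auto simp: s store_def dest: queue_snoc)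
  qed
qed

lemma sum_filter_nth:
  "(\<Sum>j<length xs. if P (xs ! j) then c else 0) = length (filter P xs) * (c :: nat)"
  by (induction xs) (simp_all add: sum.lessThan_Suc_shift del: sum.lessThan_Suc)

definition children :: "nat set \<Rightarrow> nat \<Rightarrow> nat list \<Rightarrow> (nat set \<times> nat) list" where
  "children W k us = map (\<lambda>u. (remove_closed_nbrs G W u, Suc k)) us"

text \<open>The linear cost of a copy arises only for list entries in \<open>W\<close>, that is, for
  actual children. Skipped entries cost constant time each, and the list is part of the input, so
  \<open>7 * length word\<close> covers the scan. The parent stays at the head because each copy
  reads its flags.\<close>

lemma push_children:
  assumes st: "store ((W, k) # ws) (r, m)" and r: "r rF = Suc (r rH)"
    and v: "r rPiv = v" "v < n" and q: "r rQ = Suc (offset v)" "r rQE = offset (Suc v)"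
    and us: "us = v # filter (\<lambda>u. u \<in> W) (A ! v)"
  shows "runs push_children (r, m) (13 * length word * length us + 7 * length word)
    (\<lambda>(r', m'). store ((W, k) # ws @ children W k us) (r', m') \<and>
      r' rH = r rH \<and> r' rFound = r rFound \<and> r' rRes = r rRes)"
    (is "runs _ _ _ ?Q")
proof -
  let ?X = "13 * length word"
  define I where "I = (\<lambda>j (r', m').
    store ((W, k) # ws @ children W k (v # filter (\<lambda>u. u \<in> W) (take j (A ! v)))) (r', m') \<and>
    r' rQ = Suc (offset v + j) \<and> r' rK = Suc k \<and>
    (\<forall>i. i \<notin> {rP, rV, rE, rC, rX, rA, rT, rU, rK, rQ} \<longrightarrow> r' i = r i))"
  define R0 where "R0 = (\<lambda>(r', m'). m' = m \<and> r' rK = Suc k \<and> r' rU = v \<and>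
    (\<forall>i. i \<notin> {rU, rK} \<longrightarrow> r' i = r i))"
  have "runs push_children (r, m)
      (3 + (?X + Suc (\<Sum>j<length (A ! v). Suc (3 + ((1 + (1 + (if A ! v ! j \<in> W then ?X else 0))) + 1)))))
      (I (length (A ! v)))"
    unfolding push_children_def
  proof (rule runs_Seq[where R = R0], goal_cases)
    case 1
    show ?case
      by (rule runs_straight_line) (use st v in \<open>auto simp: R0_def store_def block_def\<close>)
  next
    case (2 s)
    obtain r' m' where s: "s = (r', m')" by fastforce
    have "store ((W, k) # ws) (r', m')" using st 2 by (auto simp: store_def R0_def s)
    note push = push_child[OF this refl]
    show ?case
    proof (rule runs_Seq[where R = "I 0"], goal_cases)
      case 1
      show ?case unfolding s
        by (rule runs_weaken[OF push]) (use 2 r q in \<open>auto simp: R0_def I_def s children_def\<close>)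
    next
      case (2 s)
      show ?case
      proof (rule runs_While_count, goal_cases)
        case 1
        show ?case by (rule 2)
      next
        case (2 j s)
        obtain r' m' where s: "s = (r', m')" by fastforce
        have I: "I j (r', m')" using 2 s by simp
        then have m': "has_input m'" "flags m' (r' rF) W" "r' rF = Suc (r' rH)" and [simp]: "r' rOne = 1"
          using r by (auto simp: I_def store_def block_def)
        let ?u = "A ! v ! j"
        have u: "?u < n" using nth_A[OF v(2) 2(1)] by simp
        define R1 where "R1 = (\<lambda>(r2, m2). m2 = m' \<and> r2 rU = ?u \<and> r2 rX = of_bool (?u \<in> W) \<and>
          (\<forall>i. i \<notin> {rU, rA, rX} \<longrightarrow> r2 i = r' i))"
        define R2 where "R2 = (\<lambda>(r2, m2).
          store ((W, k) # ws @ children W k (v # filter (\<lambda>u. u \<in> W) (take (Suc j) (A ! v)))) (r2, m2) \<and>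
          (\<forall>i. i \<notin> {rP, rV, rE, rC, rX, rA, rT, rU} \<longrightarrow> r2 i = r' i))"
        show ?case unfolding s
        proof (rule runs_Seq[where R = R1], goal_cases)
          case 1
          show ?case
            by (rule runs_straight_line)
              (use I m' u v 2(1) in \<open>auto simp: I_def R1_def has_inputD flags_def\<close>)
        next
          case (2 s2)
          obtain r2 m2 where s2: "s2 = (r2, m2)" by fastforce
          have st2: "store (((W, k) # ws @ children W k (v # filter (\<lambda>u. u \<in> W) (take j (A ! v))))) (r2, m2)"
            using 2 I by (auto simp: I_def R1_def s2 store_def)
          note push2 = push_child[OF st2 refl]
          have [simp]: "r2 rOne = 1" using st2 by (simp add: store_def)
          have X: "r2 rX = of_bool (?u \<in> W)" using 2 by (simp add: R1_def s2)
          have t: "take (Suc j) (A ! v) = take j (A ! v) @ [?u]"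
            using \<open>j < length (A ! v)\<close> by (rule take_Suc_conv_app_nth)
          show ?case unfolding s2
          proof (rule runs_Seq[where R = R2], rule runs_Cond, goal_cases)
            case 1
            then have W: "?u \<in> W" by (simp add: X of_bool_def split: if_splits)
            show ?case
              by (rule runs_weaken[OF push2])
                (use W 2 I m' in \<open>auto simp: R2_def R1_def I_def s2 t children_def\<close>)
          next
            case 2
            then have W: "?u \<notin> W" by (simp add: X of_bool_def split: if_splits)
            show ?case
              by (rule runs_straight_line)
                (use W st2 \<open>R1 s2\<close> in \<open>auto simp: R2_def R1_def s2 t\<close>)
          next
            case (3 s3)
            obtain r3 m3 where s3: "s3 = (r3, m3)" by fastforce
            have st3: "store ((W, k) # ws @ children W k (v # filter (\<lambda>u. u \<in> W) (take (Suc j) (A ! v)))) (r3, m3)"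
              using 3 by (simp add: R2_def s3)
            then have "store ((W, k) # ws @ children W k (v # filter (\<lambda>u. u \<in> W) (take (Suc j) (A ! v))))
              (r3(rQ := Suc (r3 rQ)), m3)" and "r3 rOne = 1"
              by (simp_all add: store_def)
            then show ?case unfolding s3
              by (intro runs_straight_line) (use 3 I in \<open>auto simp: R2_def I_def s3\<close>)
          qed
        qed
      next
        case (3 j s)
        then show ?case using q by (cases s) (auto simp: I_def offset_Suc)
      qed
    qed
  qed
  moreover have "3 + (?X + Suc (\<Sum>j<length (A ! v). Suc (3 + ((1 + (1 + (if A ! v ! j \<in> W then ?X else 0))) + 1))))
    \<le> ?X * length us + 7 * length word"
  proof -
    \<comment> \<open>Seven steps for every list entry, plus one copy for every entry in
      \<open>W\<close>.\<close>
    have "(\<Sum>j<length (A ! v). Suc (3 + ((1 + (1 + (if A ! v ! j \<in> W then ?X else 0))) + 1)))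
      = 7 * length (A ! v) + length (filter (\<lambda>u. u \<in> W) (A ! v)) * ?X"
      by (simp add: sum.distrib sum_filter_nth[where P = "\<lambda>u. u \<in> W"])
    moreover have "offset v + length (A ! v) < length word" "2 \<le> offset v"
      using nth_word(2)[OF v(2) order_refl] by (auto simp: offset_def)
    ultimately show ?thesis by (simp add: us algebra_simps)
  qed
  ultimately show ?thesis
    by (rule runs_weaken) (auto simp: I_def us)
qed

section \<open>Search invariant and amortised time\<close>

definition seen :: "nat set \<Rightarrow> nat \<Rightarrow> nat \<Rightarrow> bool" where
  "seen D f y \<longleftrightarrow> y = of_bool (D \<subseteq> {f}) \<and> (if D = {} then f = 0 else f \<in> D \<and> 0 < f)"

text \<open>The three cases are the branches of \<open>visit_leaf\<close>. As recorded depths are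
  positive, \<open>f = 0\<close> means that \<open>D\<close> is empty; a single mismatch settles the
  answer.\<close>

lemma seen_insert:
  assumes "seen D f y" and "0 < k"
  shows "f = 0 \<Longrightarrow> seen (insert k D) k y"
    and "f = k \<Longrightarrow> seen (insert k D) f y"
    and "f \<noteq> 0 \<Longrightarrow> f \<noteq> k \<Longrightarrow> seen (insert k D) f 0"
  using assms by (auto simp: seen_def split: if_splits)

text \<open>A node at depth \<open>k\<close> is the root of a search tree of
  height at most \<open>alpha G + 1 - k\<close>.\<close>

definition potential :: "(nat set \<times> nat) list \<Rightarrow> nat" where
  "potential ws =
     (\<Sum>(W, k)\<leftarrow>ws. 26 * length word * tree_time (degeneracy G + 1) (alpha G + 1 - k))"

text \<open>Depths already seen and depths below pending nodes together give those of the root. The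
  union need not be disjoint, which accommodates repeated leaves.\<close>

definition search_inv :: "nat \<Rightarrow> state \<Rightarrow> bool" where
  "search_inv p s \<longleftrightarrow> (\<exists>ws D. store ws s \<and> p = potential ws \<and>
     (\<forall>(W, k)\<in>set ws. fits G W k \<and> 0 < k) \<and>
     D \<union> (\<Union>(W, k)\<in>set ws. depths G W k) = depths G (verts G) 1 \<and>
     seen D (fst s rFound) (fst s rRes))"

lemma length_word_ge: "2 \<le> length word"
  by (simp add: word_def)

text \<open>One unfolding of \<open>tree_time\<close>. The bound on \<open>k\<close> ensures that
  the truncated difference \<open>alpha G + 1 - k\<close> is a successor, whose predecessor is the
  height left to the children.\<close>

lemma children_potential:
  assumes "length us \<le> degeneracy G + 1" and "k \<le> alpha G"
  shows "26 * length word * (1 + length us) + potential (children W k us) \<le> potential [(W, k)]"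
proof -
  let ?b = "degeneracy G + 1" and ?a = "alpha G - k"
  have "potential (children W k us) = 26 * length word * (length us * tree_time ?b ?a)"
    by (simp add: potential_def children_def o_def sum_list_triv)
  then have "26 * length word * (1 + length us) + potential (children W k us)
      = 26 * length word * (1 + length us + length us * tree_time ?b ?a)"
    by (simp only: distrib_left)
  also have "\<dots> \<le> 26 * length word * (1 + ?b + ?b * tree_time ?b ?a)"
    using assms(1) by (intro mult_le_mono2 add_mono mult_le_mono1) auto
  also have "\<dots> = potential [(W, k)]"
    using assms(2) by (simp add: potential_def Suc_diff_le)
  finally show ?thesis .
qed

text \<open>A leaf moves its depth into \<open>D\<close>; an inner node is replaced by its children,
  with the same union of depths by \<open>depths_branch\<close>. In both cases the drop in potential
  pays for the visit.\<close>

lemma visit_node: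
  assumes inv: "search_inv p s" and ne: "holds (Less rH rT) (fst s)"
  shows "\<exists>T q. runs visit_node s T (search_inv q) \<and> Suc T + q \<le> p"
proof -
  obtain r m where s: "s = (r, m)" by fastforce
  obtain ws0 D where ws0: "store ws0 (r, m)" "p = potential ws0"
      "\<forall>(W, k)\<in>set ws0. fits G W k \<and> 0 < k"
      "D \<union> (\<Union>(W, k)\<in>set ws0. depths G W k) = depths G (verts G) 1"
      "seen D (r rFound) (r rRes)"
    using inv unfolding search_inv_def s fst_conv by (elim exE conjE)
  have fits0: "fits G W k \<and> 0 < k" if "(W, k) \<in> set ws0" for W k
    using ws0(3) that by auto
  have "ws0 \<noteq> []" using ws0(1) ne by (auto simp: store_def s)
  then obtain W k ws where wsc: "ws0 = (W, k) # ws" by (metis list.exhaust surj_pair)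
  note st = ws0(1)[unfolded wsc]
  have fit: "fits G W k" "0 < k" using fits0 by (auto simp: wsc)
  then have W: "W \<subseteq> {..<n}" by (simp add: fits_def verts)
  have r: "has_input m" "r rOne = 1" "r rZ = 0" "r rN = n" "r rN1 = Suc n" "flags m (Suc (r rH)) W" "m (r rH) = k"
    using st by (auto simp: store_def block_def)
  have pot: "p = potential [(W, k)] + potential ws" by (simp add: ws0(2) wsc potential_def)
  define R0 where "R0 = (\<lambda>(r', m'). m' = m \<and> r' rF = Suc (r rH) \<and> (\<forall>i. i \<noteq> rF \<longrightarrow> r' i = r i))"
  define R1 where "R1 = (\<lambda>(r', m'). m' = m \<and> r' rF = Suc (r rH) \<and>
    pivot_found W n (r' rBest) (r' rPiv) (r' rQ) (r' rQE) \<and>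
    (\<forall>i. i \<notin> {rF, rP, rV, rE, rC, rX, rA, rBest, rPiv, rS, rQ, rQE} \<longrightarrow> r' i = r i))"
  have start: "runs (Add rF rH rOne) s 1 R0"
    by (rule runs_straight_line) (use r in \<open>auto simp: R0_def s\<close>)
  have pivot: "runs find_pivot s' (16 * length word) R1" if "R0 s'" for s'
  proof -
    obtain r' m' where s': "s' = (r', m')" by fastforce
    show ?thesis unfolding s'
      by (rule runs_weaken[OF find_pivot[where W = W]])
        (use that r in \<open>auto simp: R0_def R1_def s'\<close>)
  qed
  \<comment> \<open>Popping the head only moves \<open>rH\<close>: the remaining blocks already form
    the new queue.\<close>
  have advance: "runs (Add rH rH rN1) s2 1 (search_inv (potential ws'))"
    if st: "store ((W, k) # ws') s2"
      and fits: "\<And>W k. (W, k) \<in> set ws' \<Longrightarrow> fits G W k \<and> 0 < k"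
      and dep: "D' \<union> (\<Union>(W, k)\<in>set ws'. depths G W k) = depths G (verts G) 1"
      and seen: "seen D' (fst s2 rFound) (fst s2 rRes)" for s2 ws' D'
  proof (rule runs_straight_line)
    obtain r2 m2 where s2: "s2 = (r2, m2)" by fastforce
    have "store ws' (effect (Add rH rH rN1) s2)"
      using st by (simp add: store_def s2)
    then show "search_inv (potential ws') (effect (Add rH rH rN1) s2)"
      unfolding search_inv_def
      by (rule_tac exI[of _ ws'], rule_tac exI[of _ D']) (use fits dep seen in \<open>auto simp: s2\<close>)
  qed auto
  obtain s0 where s0: "R0 s0"
    "\<And>c T Q. runs c s0 T Q \<Longrightarrow> runs (Add rF rH rOne ;; c) s (1 + T) Q"
    by (rule runs_Seq_obtain[OF start]) blast
  obtain s1 where s1: "R1 s1"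
    "\<And>c T Q. runs c s1 T Q \<Longrightarrow> runs (find_pivot ;; c) s0 (16 * length word + T) Q"
    by (rule runs_Seq_obtain[OF pivot[OF s0(1)]]) blast
  have node: "runs visit_node s (1 + (16 * length word + (T + 1))) (search_inv (potential ws'))"
    if c: "runs (Cond (Less rBest rN1) push_children visit_leaf) s1 T
        (\<lambda>s2. store ((W, k) # ws') s2 \<and> seen D' (fst s2 rFound) (fst s2 rRes))"
      and fits: "\<And>W k. (W, k) \<in> set ws' \<Longrightarrow> fits G W k \<and> 0 < k"
      and dep: "D' \<union> (\<Union>(W, k)\<in>set ws'. depths G W k) = depths G (verts G) 1" for T ws' D'
    unfolding visit_node_def
    by (intro s0(2) s1(2), rule runs_Seq[OF c], rule advance[OF _ fits dep]) auto
  obtain r1 m1 where r1m: "s1 = (r1, m1)" by fastforce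
  have r1: "m1 = m" "r1 rF = Suc (r1 rH)" "pivot_found W n (r1 rBest) (r1 rPiv) (r1 rQ) (r1 rQE)"
      "r1 rH = r rH" "r1 rZ = 0" "r1 rN1 = Suc n"
      "r1 rFound = r rFound" "r1 rRes = r rRes" "r1 rT = r rT" "r1 rOne = 1" "r1 rN = n"
    using s1(1) r by (auto simp: R1_def r1m)
  have st1: "store ((W, k) # ws) (r1, m1)" using st r1 by (simp add: store_def)
  show ?thesis
  proof (cases "W = {}")
    case True
    have leaf: "runs (Cond (Less rBest rN1) push_children visit_leaf) s1 (1 + 4)
        (\<lambda>s2. store ((W, k) # ws) s2 \<and> seen (insert k D) (fst s2 rFound) (fst s2 rRes))"
      (is "runs _ _ _ ?Q")
    proof (rule runs_Cond)
      have "r1 rBest = Suc n" using r1(3) True by (simp add: pivot_found_def)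
      then show "holds (Less rBest rN1) (fst s1) \<Longrightarrow> runs push_children s1 4 ?Q"
        by (simp add: r1m r1)
      have f: "seen D (r1 rFound) (r1 rRes)" "m1 (r1 rH) = k" using ws0(5) r1 r(7) by auto
      show "runs visit_leaf s1 4 ?Q"
        by (rule runs_straight_line)
          (use st1 r1(5) f(2) seen_insert[OF f(1) fit(2)] in
            \<open>auto simp: visit_leaf_def r1m store_def\<close>)
    qed
    have "runs visit_node s (1 + (16 * length word + ((1 + 4) + 1))) (search_inv (potential ws))"
      by (rule node[OF leaf]) (use fits0 ws0(4) True in \<open>auto simp: wsc depths_empty\<close>)
    moreover have "26 * length word \<le> potential [(W, k)]"
    proof -
      have "1 \<le> tree_time b a" for a b by (cases a) auto
      then show ?thesis by (simp add: potential_def)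
    qed
    then have "Suc (1 + (16 * length word + ((1 + 4) + 1))) + potential ws \<le> p"
      using length_word_ge by (simp add: pot)
    ultimately show ?thesis by blast
  next
    case False
    define v where "v = r1 rPiv"
    define us where "us = v # filter (\<lambda>u. u \<in> W) (A ! v)"
    from False W have "\<exists>x<n. x \<in> W" by auto
    with r1(3) have v: "v < n" "v \<in> W" "r1 rBest \<le> n" "r1 rBest = card (nbrs G v \<inter> W)"
        "r1 rQ = Suc (offset v)" "r1 rQE = offset (Suc v)"
        "\<And>x. x < n \<Longrightarrow> x \<in> W \<Longrightarrow> card (nbrs G v \<inter> W) \<le> card (nbrs G x \<inter> W)"
      by (auto simp: pivot_found_def v_def)
    have set_us: "set us = insert v (nbrs G v \<inter> W)"
      using set_A[OF v(1)] by (auto simp: us_def)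
    have "card (nbrs G v \<inter> W) \<le> degeneracy G"
      using W v by (intro min_degree_le_degeneracy[OF simple]) (auto simp: verts)
    then have len: "length us \<le> degeneracy G + 1"
      unfolding us_def list.size length_filter_A[OF v(1)] by linarith
    have branch: "runs (Cond (Less rBest rN1) push_children visit_leaf) s1
        (1 + (13 * length word * length us + 7 * length word))
        (\<lambda>s2. store ((W, k) # ws @ children W k us) s2 \<and> seen D (fst s2 rFound) (fst s2 rRes))"
      (is "runs _ _ _ ?Q")
    proof (rule runs_Cond)
      show "runs push_children s1 (13 * length word * length us + 7 * length word) ?Q"
        unfolding r1m
        by (rule runs_weaken[OF push_children[OF st1 r1(2) v_def[symmetric] v(1,5,6) us_def]])
          (use r1 ws0(5) in auto)
      show "\<not> holds (Less rBest rN1) (fst s1) \<Longrightarrow>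
          runs visit_leaf s1 (13 * length word * length us + 7 * length word) ?Q"
        using v(3) by (simp add: r1m r1)
    qed
    have "finite W" using W finite_subset by blast
    have "runs visit_node s
        (1 + (16 * length word + ((1 + (13 * length word * length us + 7 * length word)) + 1)))
        (search_inv (potential (ws @ children W k us)))"
    proof (rule node[OF branch], goal_cases)
      case (1 W' k')
      have "fits G (remove_closed_nbrs G W u) (Suc k)" if "u \<in> set us" for u
        using that v(2) simple by (intro fits_child[OF _ fit(1)]) (auto simp: set_us simple_graph_def)
      with 1 fits0 show ?case by (auto simp: wsc children_def)
    next
      case 2
      \<comment> \<open>The children account for exactly the depths of the parent, so
        \<open>D\<close> stays unchanged.\<close>
      have "(\<Union>(W, k)\<in>set (children W k us). depths G W k) = depths G W k"
        using depths_branch[OF \<open>finite W\<close> v(2) nbrs_irrefl[OF simple], of k]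
        by (simp add: children_def set_us)
      then show ?case using ws0(4) by (simp add: wsc Un_ac)
    qed
    moreover have "Suc (1 + (16 * length word + ((1 + (13 * length word * length us + 7 * length word)) + 1)))
        + potential (ws @ children W k us) \<le> p"
    proof -
      have "potential (ws @ children W k us) = potential ws + potential (children W k us)"
        by (simp add: potential_def)
      moreover note children_potential[OF len fits_nonempty[OF fit(1) v(2)], of W]
      \<comment> \<open>The pivot search and the scan take 16 and 7 word lengths, each child 13.
        Since the word has length at least 2, the factor 26 absorbs the constant steps as
        well.\<close>
      moreover have "Suc (1 + (16 * length word + ((1 + (13 * length word * length us + 7 * length word)) + 1)))
          \<le> 26 * length word * (1 + length us)"
        using length_word_ge by (simp add: algebra_simps)
      ultimately show ?thesis unfolding pot by linarith
    qed
    ultimately show ?thesis by blast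
  qed
qed

section \<open>Initialisation and the complete run\<close>

lemma has_input_first:
  assumes "has_input m"
  shows "m 0 = n" and "m 1 = card (edges G)"
  using assms length_word_ge by (auto simp: has_input_def word_def n_def)

lemma push_root:
  assumes m: "has_input m" and r: "r rX = card (edges G)" "r rN = n" "r rN1 = Suc n" "r rOne = 1"
      "r rZ = 0" "r rV = 0"
  shows "runs push_root (r, m) (6 + 4 * n) (\<lambda>(r', m'). store [(verts G, 1)] (r', m') \<and>
    r' rFound = r rFound \<and> r' rRes = r rRes)"
    (is "runs _ _ _ ?Q")
proof -
  define h where "h = card (edges G) + card (edges G) + Suc n + 1"
  have h: "length word \<le> h" using length_word_le by (simp add: h_def)
  define I where "I = (\<lambda>v (r', m'). r' rV = v \<and> r' rH = h \<and> r' rT = Suc (h + v) \<and>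
    (\<forall>a<h. m' a = m a) \<and> m' h = (1 :: nat) \<and> (\<forall>x<v. m' (Suc (h + x)) = 1) \<and>
    (\<forall>i. i \<notin> {rV, rH, rT} \<longrightarrow> r' i = r i))"
  have "runs push_root (r, m) (5 + Suc (\<Sum>v<n. Suc 3)) (I n)"
    unfolding push_root_def
  proof (rule runs_Seq[where R = "I 0"], goal_cases)
    case 1
    show ?case by (rule runs_straight_line) (use r in \<open>auto simp: I_def h_def\<close>)
  next
    case (2 s)
    then show ?case
    proof (rule runs_While_count, goal_cases)
      case (1 v s)
      obtain r' m' where s: "s = (r', m')" by fastforce
      show ?case unfolding s
        by (rule runs_straight_line) (use 1 r in \<open>auto simp: I_def s less_Suc_eq\<close>)
    next
      case (2 v s)
      then show ?case using r by (cases s) (auto simp: I_def)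
    qed
  qed
  then show ?thesis
  proof (rule runs_weaken, goal_cases)
    case (2 s)
    obtain r' m' where s: "s = (r', m')" by fastforce
    have "has_input m'" using 2 h by (intro has_input_cong[OF m]) (simp add: I_def s)
    with 2 h r show ?case by (auto simp: I_def s store_def block_def flags_def verts)
  qed simp
qed

lemma well_covered_edgeless:
  assumes "edges G = {}"
  shows "well_covered G"
proof -
  have "S = verts G" if "mis_in G (verts G) S" for S
    using that assms by (auto simp: mis_in_def nbrs_def)
  then show ?thesis by (auto simp: well_covered_def maximal_independent_set_iff)
qed

lemma well_covered_program:
  "\<exists>t \<le> 114 * (degeneracy G + 1) ^ alpha G * length word.
     halts_with well_covered_program word (of_bool (well_covered G)) t"
proof -
  let ?b = "degeneracy G + 1" and ?L = "length word"
  let ?R = "\<lambda>s. fst s rRes = of_bool (well_covered G)"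
  let ?T = "114 * ?b ^ alpha G * ?L"
  obtain r0 m0 where init: "initial_state word = (r0, m0)" by fastforce
  have m0: "has_input m0" and r0: "r0 = (\<lambda>_. 0)"
    using init by (auto simp: initial_state_def has_input_def)
  define R0 where "R0 = (\<lambda>(r, m). has_input m \<and> r rX = card (edges G) \<and> r rN = n \<and> r rN1 = Suc n \<and>
    r rOne = 1 \<and> r rZ = 0 \<and> r rV = 0 \<and> r rFound = 0 \<and> r rRes = 1)"
  have start: "runs (Const rOne 1 ;; Load rX rOne ;; Load rN rZ ;; Add rN1 rN rOne ;; Const rRes 1)
      (initial_state word) 5 R0"
    by (rule runs_straight_line) (use m0 r0 has_input_first in \<open>auto simp: R0_def init\<close>)
  have pos: "1 \<le> ?b ^ alpha G" by simp
  have L: "2 * ?b ^ alpha G \<le> ?b ^ alpha G * ?L" using length_word_ge by simp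
  have "runs well_covered_program (initial_state word) ?T ?R"
  proof (cases "edges G = {}")
    case True
    have "runs well_covered_program (initial_state word) (5 + (1 + 1)) ?R"
      unfolding well_covered_program_def
    proof (rule runs_Seq[OF start], rule runs_Cond, goal_cases)
      case (1 s)
      then show ?case
        by (intro runs_straight_line) (auto simp: R0_def well_covered_edgeless[OF True])
    qed (use True in \<open>auto simp: R0_def\<close>)
    moreover have "5 + (1 + 1) \<le> ?T" unfolding mult.assoc using pos L by linarith
    ultimately show ?thesis by (rule runs_weaken)
  next
    case False
    then have m: "card (edges G) \<noteq> 0" using simple_graph_finite_edges[OF simple] by simp
    have b: "2 \<le> ?b" using degeneracy_pos[OF simple False] by simp
    have "runs well_covered_program (initial_state word)
        (5 + (1 + ((6 + 4 * n) + Suc (potential [(verts G, 1)])))) ?R"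
      unfolding well_covered_program_def
    proof (rule runs_Seq[OF start], rule runs_Cond, goal_cases)
      case (1 s)
      with m show ?case by (auto simp: R0_def)
    next
      case (2 s)
      obtain r m where s: "s = (r, m)" by fastforce
      show ?case
      proof (rule runs_Seq[where R = "search_inv (potential [(verts G, 1)])"], goal_cases)
        case 1
        show ?case unfolding s
        proof (rule runs_weaken[OF push_root order_refl], goal_cases)
          case (8 s')
          have "fits G (verts G) 1" using simple by (intro fits_verts) (simp add: simple_graph_def)
          with 8 2 show ?case
            unfolding search_inv_def
            by (intro exI[of _ "[(verts G, 1)]"] exI[of _ "{}"])
              (auto simp: R0_def s seen_def split: prod.splits)
        qed (use 2 in \<open>auto simp: R0_def s\<close>)
      next
        case (2 s')
        show ?case
        proof (rule runs_weaken[OF runs_While_potential[OF visit_node 2] order_refl], goal_cases)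
          case (3 s'')
          then obtain ws D where ws: "store ws s''" "\<not> fst s'' rH < fst s'' rT"
              "D \<union> (\<Union>(W, k)\<in>set ws. depths G W k) = depths G (verts G) 1"
              "seen D (fst s'' rFound) (fst s'' rRes)"
            unfolding search_inv_def by auto
          have "fst s'' rT = fst s'' rH + length ws * Suc n"
            using ws(1) queue_length by (cases s'') (auto simp: store_def)
          with ws(2) have "ws = []" by (cases ws) auto
          with ws(3) have D: "D = depths G (verts G) 1" by simp
          \<comment> \<open>The queue is empty, so \<open>D\<close> holds all leaf depths; it
            contains \<open>rFound\<close> unless it is empty, so equality of all depths amounts to
            \<open>D \<subseteq> {rFound}\<close>.\<close>
          have "well_covered G \<longleftrightarrow> D \<subseteq> {fst s'' rFound}"
            unfolding well_covered_iff_depths[of G 1] D[symmetric]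
            using ws(4) by (auto simp: seen_def split: if_splits)
          with ws(4) show ?case by (simp add: seen_def)
        qed
      qed
    qed
    moreover have "5 + (1 + ((6 + 4 * n) + Suc (potential [(verts G, 1)]))) \<le> ?T"
    proof -
      have "potential [(verts G, 1)] = 26 * ?L * tree_time ?b (alpha G)"
        by (simp add: potential_def)
      also have "\<dots> \<le> 26 * ?L * (4 * ?b ^ alpha G)"
        by (rule mult_le_mono2[OF tree_time_le[OF b]])
      finally have p: "potential [(verts G, 1)] \<le> 104 * (?b ^ alpha G * ?L)"
        by (simp add: algebra_simps)
      have "?L \<le> ?b ^ alpha G * ?L" using pos by simp
      moreover have "2 + n \<le> ?L" by (simp add: length_word offset_eq)
      \<comment> \<open>Set-up is linear and gets the share 10; with \<open>104 = 26 * 4\<close>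
        from the tree this makes 114.\<close>
      ultimately have "13 + 4 * n \<le> 10 * (?b ^ alpha G * ?L)" by linarith
      with p have "5 + (1 + ((6 + 4 * n) + Suc (potential [(verts G, 1)]))) \<le> 114 * (?b ^ alpha G * ?L)"
        by linarith
      then show ?thesis by (simp only: mult.assoc)
    qed
    ultimately show ?thesis by (rule runs_weaken) auto
  qed
  then show ?thesis unfolding runs_def halts_with_def by blast
qed

end

theorem theorem12:
  shows "fpt2 input_graphs graph_inputs well_covered alpha degeneracy \<and>
    (\<exists>(P :: com) (C :: nat). \<forall>G\<in>input_graphs. \<forall>w\<in>graph_inputs G. \<exists>t.
       halts_with P w (of_bool (well_covered G)) t \<and>
       (verts G \<noteq> {} \<longrightarrow>
          t \<le> C * ((degeneracy G + 1) ^ alpha G * (card (edges G) + card (verts G)))))"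
proof
  have run: "\<exists>t \<le> 114 * (degeneracy G + 1) ^ alpha G * length w.
      halts_with well_covered_program w (of_bool (well_covered G)) t"
    and len: "length w \<le> 2 + card (verts G) + 2 * card (edges G)"
    if "G \<in> input_graphs" "w \<in> graph_inputs G" for G w
  proof -
    obtain A where A: "adjacency_lists G A"
      "w = [card (verts G), card (edges G)] @ concat (map (\<lambda>l. length l # l) A)"
      using \<open>w \<in> graph_inputs G\<close> unfolding graph_inputs_def by blast
    interpret graph_word G A by unfold_locales (use that A in auto)
    have w: "w = word" unfolding A word_def ..
    show "\<exists>t \<le> 114 * (degeneracy G + 1) ^ alpha G * length w.
        halts_with well_covered_program w (of_bool (well_covered G)) t"
      unfolding w by (rule well_covered_program)
    show "length w \<le> 2 + card (verts G) + 2 * card (edges G)"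
      using length_word_le unfolding w n_def .
  qed
  show "fpt2 input_graphs graph_inputs well_covered alpha degeneracy"
    unfolding fpt2_def
    \<comment> \<open>The running time is linear in the word length, so the exponent is 1.\<close>
    by (rule exI[of _ well_covered_program], rule exI[of _ "\<lambda>a b. 114 * (b + 1) ^ a"], rule exI[of _ 1])
      (use run computable2_power in auto)
  show "\<exists>(P :: com) (C :: nat). \<forall>G\<in>input_graphs. \<forall>w\<in>graph_inputs G. \<exists>t.
       halts_with P w (of_bool (well_covered G)) t \<and>
       (verts G \<noteq> {} \<longrightarrow>
          t \<le> C * ((degeneracy G + 1) ^ alpha G * (card (edges G) + card (verts G))))"
  \<comment> \<open>The constant is \<open>342 = 3 * 114\<close>: with at least one vertex,
    \<open>2 + n + 2 * m \<le> 3 * (m + n)\<close>. For the empty graph \<open>m + n\<close> is 0,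
    whereas every run takes at least one step.\<close>
  proof (rule exI[of _ well_covered_program], rule exI[of _ 342], intro ballI)
    fix G w assume Gw: "G \<in> input_graphs" "w \<in> graph_inputs G"
    obtain t where t: "t \<le> 114 * (degeneracy G + 1) ^ alpha G * length w"
      "halts_with well_covered_program w (of_bool (well_covered G)) t"
      using run[OF Gw] by blast
    have "t \<le> 342 * ((degeneracy G + 1) ^ alpha G * (card (edges G) + card (verts G)))"
      if "verts G \<noteq> {}"
    proof -
      have "finite (verts G)" using Gw(1) by (simp add: input_graphs_def simple_graph_def)
      with that have "1 \<le> card (verts G)" by (simp add: Suc_le_eq card_gt_0_iff)
      with len[OF Gw] have "length w \<le> 3 * (card (edges G) + card (verts G))" by simp
      then have "114 * (degeneracy G + 1) ^ alpha G * length w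
          \<le> 114 * (degeneracy G + 1) ^ alpha G * (3 * (card (edges G) + card (verts G)))"
        by (rule mult_le_mono2)
      with t(1) show ?thesis by (simp only: mult.assoc mult.left_commute)
    qed
    with t(2) show "\<exists>t. halts_with well_covered_program w (of_bool (well_covered G)) t \<and>
       (verts G \<noteq> {} \<longrightarrow>
          t \<le> 342 * ((degeneracy G + 1) ^ alpha G * (card (edges G) + card (verts G))))"
      by blast
  qed
qed

end
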